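(* Let $n\geq 2$ be an integer. Let $N$ be an abelian group of order $2^n$ with exponent $2^d$. Suppose that there is a regular quaternion or dihedral subgroup (that is, a regular subgroup isomorphic to $Q_{2^n}$ or $D_{2^n}$) of $\mathrm{Hol}(N)$. Then $N$ is isomorphic to one of the following groups: - $C_{2^n}$ for $n\geq 2$; - $C_2\times C_{2^{n-1}}$ for $n\geq 2$; - $C_4\times C_{2^{n-2}}$ for $n\geq 3$; - $C_2\times C_2\times C_{2^{n-2}}$ for $n\geq 3$; - $C_2\times C_2\times C_2\times C_{2^{n-3}}$ for $n\geq 4$.
   Context: $C_k$ denotes the cyclic group of order $k$. The holomorph $\mathrm{Hol}(N)=N\rtimes\mathrm{Aut}(N)$ is viewed as a group of permutations of $N$ (with $N$ acting by translations). A subgroup $M$ of $\mathrm{Perm}(X)$ is regular if for any $x,y\in X$ there is a unique $\pi\in M$ with $\pi(x)=y$. $Q_{2^n}=\langle x,y: x^{2^{n-1}}=1,\ yx=x^{-1}y,\ y^2=x^{2^{n-2}}\rangle$ and $D_{2^n}=\langle x,y: x^{2^{n-1}}=1,\ yx=x^{-1}y,\ y^2=1\rangle$, both of order $2^n$, including the degenerate cases $Q_4\cong C_4$, $D_4\cong C_2\times C_2$. *)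

theory Defs
  imports "HOL-Algebra.Bij" "HOL-Algebra.Elementary_Groups"
begin

section \<open>Exponent and cyclic groups\<close>

definition group_exponent :: "('a, 'b) monoid_scheme \<Rightarrow> nat" where
  "group_exponent G = (LEAST m. 0 < m \<and> (\<forall>x\<in>carrier G. x [^]\<^bsub>G\<^esub> m = \<one>\<^bsub>G\<^esub>))"

abbreviation cyclic :: "nat \<Rightarrow> int monoid" where
  "cyclic k \<equiv> integer_mod_group k"

section \<open>The holomorph as a permutation group\<close>

definition semidirect_Aut :: "('a, 'b) monoid_scheme \<Rightarrow> ('a \<times> ('a \<Rightarrow> 'a)) monoid" where
  "semidirect_Aut G =
    \<lparr>carrier = carrier G \<times> carrier (AutoGroup G),
     mult = (\<lambda>(a, f) (b, g). (a \<otimes>\<^bsub>G\<^esub> f b, f \<otimes>\<^bsub>AutoGroup G\<^esub> g)),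
     one = (\<one>\<^bsub>G\<^esub>, \<one>\<^bsub>AutoGroup G\<^esub>)\<rparr>"

definition semidirect_Aut_perm ::
    "('a, 'b) monoid_scheme \<Rightarrow> 'a \<times> ('a \<Rightarrow> 'a) \<Rightarrow> 'a \<Rightarrow> 'a" where
  "semidirect_Aut_perm G = (\<lambda>(a, f). \<lambda>x\<in>carrier G. a \<otimes>\<^bsub>G\<^esub> f x)"

text \<open>The image of the semidirect product in \<^term>\<open>BijGroup (carrier G)\<close>; the action is
  faithful, see \<open>inj_on_semidirect_Aut_perm\<close> below.\<close>

definition Hol :: "('a, 'b) monoid_scheme \<Rightarrow> ('a \<Rightarrow> 'a) monoid" where
  "Hol G = BijGroup (carrier G)
     \<lparr>carrier := semidirect_Aut_perm G ` carrier (semidirect_Aut G)\<rparr>"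

definition regular_on :: "('a \<Rightarrow> 'a) set \<Rightarrow> 'a set \<Rightarrow> bool" where
  "regular_on M X \<longleftrightarrow> (\<forall>x\<in>X. \<forall>y\<in>X. \<exists>!p. p \<in> M \<and> p x = y)"

lemma carrier_AutoGroup: "carrier (AutoGroup G) = auto G"
  by (simp add: AutoGroup_def)

context group
begin

lemma auto_closed: "f \<in> auto G \<Longrightarrow> x \<in> carrier G \<Longrightarrow> f x \<in> carrier G"
  by (auto simp: auto_def hom_def)

lemma auto_mult:
  "f \<in> auto G \<Longrightarrow> x \<in> carrier G \<Longrightarrow> y \<in> carrier G \<Longrightarrow> f (x \<otimes> y) = f x \<otimes> f y"
  by (auto simp: auto_def hom_def)

lemma auto_one: "f \<in> auto G \<Longrightarrow> f \<one> = \<one>"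
  by (auto simp: auto_def intro!: hom_one is_group)

lemma mult_AutoGroup_apply:
  "f \<in> auto G \<Longrightarrow> g \<in> auto G \<Longrightarrow> x \<in> carrier G \<Longrightarrow> (f \<otimes>\<^bsub>AutoGroup G\<^esub> g) x = f (g x)"
  by (auto simp: AutoGroup_def BijGroup_def auto_def compose_def)

lemma one_AutoGroup_apply: "x \<in> carrier G \<Longrightarrow> \<one>\<^bsub>AutoGroup G\<^esub> x = x"
  by (simp add: AutoGroup_def BijGroup_def)

lemma group_semidirect_Aut: "group (semidirect_Aut G)"
proof -
  interpret A: group "AutoGroup G" by (rule AutoGroup)
  have cl: "f \<otimes>\<^bsub>AutoGroup G\<^esub> g \<in> auto G" if "f \<in> auto G" "g \<in> auto G" for f g
    using A.m_closed that by (simp add: carrier_AutoGroup)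
  show ?thesis
  proof (rule groupI)
    fix x y assume "x \<in> carrier (semidirect_Aut G)" "y \<in> carrier (semidirect_Aut G)"
    then show "x \<otimes>\<^bsub>semidirect_Aut G\<^esub> y \<in> carrier (semidirect_Aut G)"
      by (auto simp: semidirect_Aut_def carrier_AutoGroup auto_closed cl)
  next
    show "\<one>\<^bsub>semidirect_Aut G\<^esub> \<in> carrier (semidirect_Aut G)"
      by (simp add: semidirect_Aut_def)
  next
    fix x y z
    assume "x \<in> carrier (semidirect_Aut G)" "y \<in> carrier (semidirect_Aut G)"
      "z \<in> carrier (semidirect_Aut G)"
    then show "x \<otimes>\<^bsub>semidirect_Aut G\<^esub> y \<otimes>\<^bsub>semidirect_Aut G\<^esub> z =
        x \<otimes>\<^bsub>semidirect_Aut G\<^esub> (y \<otimes>\<^bsub>semidirect_Aut G\<^esub> z)"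
      using A.m_assoc
      by (auto simp: semidirect_Aut_def carrier_AutoGroup auto_closed auto_mult
          mult_AutoGroup_apply m_assoc)
  next
    fix x assume "x \<in> carrier (semidirect_Aut G)"
    then show "\<one>\<^bsub>semidirect_Aut G\<^esub> \<otimes>\<^bsub>semidirect_Aut G\<^esub> x = x"
      using A.l_one by (auto simp: semidirect_Aut_def carrier_AutoGroup one_AutoGroup_apply)
  next
    fix x assume "x \<in> carrier (semidirect_Aut G)"
    then obtain a f where x: "x = (a, f)" "a \<in> carrier G" "f \<in> auto G"
      by (auto simp: semidirect_Aut_def carrier_AutoGroup)
    define g where "g = inv\<^bsub>AutoGroup G\<^esub> f"
    have g: "g \<in> auto G" "g \<otimes>\<^bsub>AutoGroup G\<^esub> f = \<one>\<^bsub>AutoGroup G\<^esub>"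
      using A.inv_closed A.l_inv x by (auto simp: g_def carrier_AutoGroup)
    have "g (inv a) \<otimes> g a = \<one>"
      using auto_mult[OF g(1), of "inv a" a] x auto_one[OF g(1)] by simp
    then have "(g (inv a), g) \<otimes>\<^bsub>semidirect_Aut G\<^esub> x = \<one>\<^bsub>semidirect_Aut G\<^esub>"
      using g x by (simp add: semidirect_Aut_def)
    moreover have "(g (inv a), g) \<in> carrier (semidirect_Aut G)"
      using g x by (simp add: semidirect_Aut_def carrier_AutoGroup auto_closed)
    ultimately show "\<exists>y\<in>carrier (semidirect_Aut G).
        y \<otimes>\<^bsub>semidirect_Aut G\<^esub> x = \<one>\<^bsub>semidirect_Aut G\<^esub>" by blast
  qed
qed

lemma semidirect_Aut_perm_Bij:
  assumes "a \<in> carrier G" "f \<in> auto G"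
  shows "semidirect_Aut_perm G (a, f) \<in> Bij (carrier G)"
proof -
  have "bij_betw f (carrier G) (carrier G)"
    using assms by (simp add: auto_def Bij_def)
  moreover have "bij_betw (\<lambda>x. a \<otimes> x) (carrier G) (carrier G)"
    using assms(1) by (intro bij_betwI[where g = "\<lambda>x. inv a \<otimes> x"])
      (auto simp: m_assoc[symmetric])
  ultimately have "bij_betw ((\<lambda>x. a \<otimes> x) \<circ> f) (carrier G) (carrier G)"
    by (rule bij_betw_trans)
  then have "bij_betw (semidirect_Aut_perm G (a, f)) (carrier G) (carrier G)"
    by (subst bij_betw_cong[where g = "(\<lambda>x. a \<otimes> x) \<circ> f"])
      (auto simp: semidirect_Aut_perm_def)
  then show ?thesis
    by (simp add: Bij_def semidirect_Aut_perm_def)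
qed

lemma semidirect_Aut_perm_hom:
  "semidirect_Aut_perm G \<in> hom (semidirect_Aut G) (BijGroup (carrier G))"
proof (rule homI)
  fix x assume "x \<in> carrier (semidirect_Aut G)"
  then show "semidirect_Aut_perm G x \<in> carrier (BijGroup (carrier G))"
    by (auto simp: semidirect_Aut_def carrier_AutoGroup BijGroup_def
        intro!: semidirect_Aut_perm_Bij)
next
  fix x y assume "x \<in> carrier (semidirect_Aut G)" "y \<in> carrier (semidirect_Aut G)"
  then obtain a f b g where x: "x = (a, f)" "a \<in> carrier G" "f \<in> auto G"
    and y: "y = (b, g)" "b \<in> carrier G" "g \<in> auto G"
    by (auto simp: semidirect_Aut_def carrier_AutoGroup)
  have "semidirect_Aut_perm G (a \<otimes> f b, f \<otimes>\<^bsub>AutoGroup G\<^esub> g) =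
      compose (carrier G) (semidirect_Aut_perm G (a, f)) (semidirect_Aut_perm G (b, g))"
    using x y by (auto simp: semidirect_Aut_perm_def compose_def fun_eq_iff restrict_def
        mult_AutoGroup_apply auto_closed auto_mult m_assoc)
  then show "semidirect_Aut_perm G (x \<otimes>\<^bsub>semidirect_Aut G\<^esub> y) =
      semidirect_Aut_perm G x \<otimes>\<^bsub>BijGroup (carrier G)\<^esub> semidirect_Aut_perm G y"
    using x y by (simp add: semidirect_Aut_def BijGroup_def semidirect_Aut_perm_Bij)
qed

lemma inj_on_semidirect_Aut_perm:
  "inj_on (semidirect_Aut_perm G) (carrier (semidirect_Aut G))"
proof (rule inj_onI)
  fix x y assume "x \<in> carrier (semidirect_Aut G)" "y \<in> carrier (semidirect_Aut G)"
    and eq: "semidirect_Aut_perm G x = semidirect_Aut_perm G y"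
  then obtain a f b g where x: "x = (a, f)" "a \<in> carrier G" "f \<in> auto G"
    and y: "y = (b, g)" "b \<in> carrier G" "g \<in> auto G"
    by (auto simp: semidirect_Aut_def carrier_AutoGroup)
  have *: "a \<otimes> f z = b \<otimes> g z" if "z \<in> carrier G" for z
    using fun_cong[OF eq, of z] that x(1) y(1) by (simp add: semidirect_Aut_perm_def)
  have ab: "a = b"
    using *[of \<one>] x y by (simp add: auto_one)
  have "f = g"
  proof (rule extensionalityI)
    show "f \<in> extensional (carrier G)" "g \<in> extensional (carrier G)"
      using x y by (auto simp: auto_def Bij_def)
    fix z assume z: "z \<in> carrier G"
    show "f z = g z"
      using *[OF z] ab x y z by (simp add: auto_closed)
  qed
  with ab x y show "x = y" by simp
qed

end

section \<open>Groups given by generators and relations\<close>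

text \<open>A word over generators of type \<^typ>\<open>'g\<close> is a list of letters, where \<open>(g, True)\<close> stands for
  the generator \<open>g\<close> and \<open>(g, False)\<close> for its formal inverse. A pair \<open>(u, v)\<close> in \<open>R\<close> is the relation
  \<open>u = v\<close>.\<close>

type_synonym 'g word = "('g \<times> bool) list"

inductive pres_eq :: "('g word \<times> 'g word) set \<Rightarrow> 'g word \<Rightarrow> 'g word \<Rightarrow> bool" for R where
  rel: "(u, v) \<in> R \<Longrightarrow> pres_eq R u v"
| cancel: "pres_eq R [(g, b), (g, \<not> b)] []"
| refl: "pres_eq R u u"
| sym: "pres_eq R u v \<Longrightarrow> pres_eq R v u"
| trans: "pres_eq R u v \<Longrightarrow> pres_eq R v w \<Longrightarrow> pres_eq R u w"
| append: "pres_eq R u u' \<Longrightarrow> pres_eq R v v' \<Longrightarrow> pres_eq R (u @ v) (u' @ v')"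

definition pres_class :: "('g word \<times> 'g word) set \<Rightarrow> 'g word \<Rightarrow> 'g word set" where
  "pres_class R u = {v. pres_eq R u v}"

definition presented_group :: "('g word \<times> 'g word) set \<Rightarrow> 'g word set monoid" where
  "presented_group R =
    \<lparr>carrier = range (pres_class R),
     mult = (\<lambda>A B. \<Union>u\<in>A. \<Union>v\<in>B. pres_class R (u @ v)),
     one = pres_class R []\<rparr>"

lemma pres_class_eq_iff: "pres_class R u = pres_class R v \<longleftrightarrow> pres_eq R u v"
  unfolding pres_class_def set_eq_iff mem_Collect_eq
  by (metis pres_eq.refl pres_eq.sym pres_eq.trans)

lemma mult_pres_class:
  "pres_class R u \<otimes>\<^bsub>presented_group R\<^esub> pres_class R v = pres_class R (u @ v)"
proof -
  have "pres_class R (u' @ v') = pres_class R (u @ v)"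
    if "u' \<in> pres_class R u" "v' \<in> pres_class R v" for u' v'
    using that unfolding pres_class_eq_iff
    by (auto simp: pres_class_def intro: pres_eq.sym pres_eq.append)
  moreover have "u \<in> pres_class R u" "v \<in> pres_class R v"
    by (auto simp: pres_class_def intro: pres_eq.refl)
  ultimately have "(\<Union>u'\<in>pres_class R u. \<Union>v'\<in>pres_class R v. pres_class R (u' @ v')) =
      pres_class R (u @ v)"
    by blast
  then show ?thesis
    by (simp add: presented_group_def)
qed

lemma pres_eq_inverse:
  "pres_eq R (rev (map (\<lambda>(g, b). (g, \<not> b)) w) @ w) []"
proof (induction w)
  case Nil
  show ?case by (simp add: pres_eq.refl)
next
  case (Cons a w)
  obtain g b where a: "a = (g, b)" by (cases a)
  let ?v = "rev (map (\<lambda>(g, b). (g, \<not> b)) w)"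
  have "pres_eq R [(g, \<not> b), (g, b)] []"
    using pres_eq.cancel[of R g "\<not> b"] by simp
  then have "pres_eq R (?v @ ([(g, \<not> b), (g, b)] @ w)) (?v @ ([] @ w))"
    by (intro pres_eq.append pres_eq.refl)
  then have "pres_eq R (?v @ [(g, \<not> b), (g, b)] @ w) []"
    using pres_eq.trans[OF _ Cons.IH] by simp
  then show ?case by (simp add: a)
qed

lemma group_presented_group: "group (presented_group R)"
proof (rule groupI)
  fix x assume "x \<in> carrier (presented_group R)"
  then obtain w where "x = pres_class R w" by (auto simp: presented_group_def)
  moreover have "pres_class R (rev (map (\<lambda>(g, b). (g, \<not> b)) w)) \<otimes>\<^bsub>presented_group R\<^esub>
      pres_class R w = \<one>\<^bsub>presented_group R\<^esub>"
    unfolding mult_pres_class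
    by (simp add: presented_group_def pres_class_eq_iff pres_eq_inverse)
  ultimately show "\<exists>y\<in>carrier (presented_group R).
      y \<otimes>\<^bsub>presented_group R\<^esub> x = \<one>\<^bsub>presented_group R\<^esub>"
    by (auto simp: presented_group_def)
next
  have one: "\<one>\<^bsub>presented_group R\<^esub> = pres_class R []"
    and carr: "carrier (presented_group R) = range (pres_class R)"
    by (simp_all add: presented_group_def)
  show "\<one>\<^bsub>presented_group R\<^esub> \<in> carrier (presented_group R)"
    by (simp add: one carr)
  show "x \<otimes>\<^bsub>presented_group R\<^esub> y \<in> carrier (presented_group R)"
    if "x \<in> carrier (presented_group R)" "y \<in> carrier (presented_group R)" for x y
    using that by (auto simp: carr mult_pres_class)
  show "x \<otimes>\<^bsub>presented_group R\<^esub> y \<otimes>\<^bsub>presented_group R\<^esub> z =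
      x \<otimes>\<^bsub>presented_group R\<^esub> (y \<otimes>\<^bsub>presented_group R\<^esub> z)"
    if "x \<in> carrier (presented_group R)" "y \<in> carrier (presented_group R)"
      "z \<in> carrier (presented_group R)" for x y z
    using that by (auto simp: carr mult_pres_class)
  show "\<one>\<^bsub>presented_group R\<^esub> \<otimes>\<^bsub>presented_group R\<^esub> x = x"
    if "x \<in> carrier (presented_group R)" for x
    using that by (auto simp: carr one mult_pres_class)
qed

section \<open>Quaternion and dihedral groups of order \<open>2 ^ n\<close>\<close>

datatype gen = X | Y

abbreviation X_pow :: "nat \<Rightarrow> gen word" where
  "X_pow k \<equiv> replicate k (X, True)"

text \<open>Both are meant for \<open>n \<ge> 2\<close>; for smaller \<open>n\<close> the exponents truncate.\<close>

definition quaternion_group :: "nat \<Rightarrow> gen word set monoid" where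
  "quaternion_group n = presented_group
     {(X_pow (2 ^ (n - 1)), []),
      ([(Y, True), (X, True)], [(X, False), (Y, True)]),
      ([(Y, True), (Y, True)], X_pow (2 ^ (n - 2)))}"

definition dihedral_group :: "nat \<Rightarrow> gen word set monoid" where
  "dihedral_group n = presented_group
     {(X_pow (2 ^ (n - 1)), []),
      ([(Y, True), (X, True)], [(X, False), (Y, True)]),
      ([(Y, True), (Y, True)], [])}"

end

theory Submission
  imports Defs "HOL-Algebra.Multiplicative_Group" "HOL-Computational_Algebra.Primes"
begin

text \<open>
  Write \<open>N\<close> additively. Both presented groups have a cyclic subgroup of index at most 2, so a regular
  subgroup isomorphic to one of them contains an affine map \<open>p = a + f\<close> such that the orbit of 0
  under \<open>p\<close> has at least \<open>|N| / 2\<close> elements. Let \<open>r\<close> be the rank of \<open>N / 2N\<close> and \<open>u = f - 1\<close>.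
  As \<open>f\<close> has 2-power order, \<open>u\<close> is nilpotent modulo 2, hence \<open>u^r\<close> vanishes modulo 2. If
  \<open>2^k > r\<close>, the congruences \<open>f^(2^k) = 1 + u^(2^k)\<close> and \<open>p^(2^k)(0) = u^(2^k - 1)(a)\<close> modulo 2 show
  that \<open>p^(2^k)\<close> is the identity modulo \<open>2N\<close>; squaring repeatedly, \<open>p^(2^(k+j))\<close> is the identity
  modulo \<open>2^(j+1) N\<close>. The orbit of 0 therefore has at most \<open>2^(k+j) |2^(j+1) N|\<close> elements, that is,
  \<open>|N / 2^(j+1) N| \<le> 2^(k+j+1)\<close>. For \<open>j = 0\<close> this gives \<open>r \<le> 4\<close>, and for suitable \<open>j \<le> 2\<close> it bounds
  all but one of the cyclic factors of \<open>N\<close>.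
\<close>

section \<open>Iterates of affine maps of abelian 2-groups\<close>

lemma funpow_hom:
  assumes "h \<in> hom G G" shows "h ^^ m \<in> hom G G"
proof (induction m)
  case (Suc m)
  then show ?case
    using assms by (auto simp: hom_def Pi_iff)
qed (simp add: hom_def)

text \<open>Additively this is the subgroup mN. Congruence modulo m is expressed below by a
  correcting factor \<open>t\<close> in \<open>powers G m\<close>, which avoids quotient
  groups.\<close>

definition powers :: "('a, 'b) monoid_scheme \<Rightarrow> nat \<Rightarrow> 'a set" where
  "powers G m = (\<lambda>x. x [^]\<^bsub>G\<^esub> m) ` carrier G"

context comm_group
begin

lemma subgroup_powers: "subgroup (powers G m) G"
proof (rule subgroupI)
  fix x y assume "x \<in> powers G m" "y \<in> powers G m"
  then show "x \<otimes> y \<in> powers G m"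
    by (auto simp: powers_def nat_pow_distrib[symmetric])
next
  fix x assume "x \<in> powers G m"
  then show "inv x \<in> powers G m"
    by (auto simp: powers_def nat_pow_inv[symmetric])
qed (auto simp: powers_def)

lemma powers_hom:
  assumes "h \<in> hom G G" "x \<in> powers G m"
  shows "h x \<in> powers G m"
  using assms hom_nat_pow[OF assms(1) _ is_group is_group]
  by (auto simp: powers_def hom_in_carrier)

lemma powers_mult_exp:
  assumes "x \<in> powers G l"
  shows "x [^] m \<in> powers G (l * m)"
  using assms by (auto simp: powers_def nat_pow_pow)

lemma powers_dvd: "m dvd l \<Longrightarrow> powers G l \<subseteq> powers G m"
  by (auto simp: powers_def dvd_def mult.commute nat_pow_pow[symmetric])

lemma mult_div_cancel: "x \<in> carrier G \<Longrightarrow> y \<in> carrier G \<Longrightarrow> x \<otimes> (y \<otimes> inv x) = y"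
  using m_lcomm[of x y "inv x"] by simp

lemma square_in_powers: "x \<in> carrier G \<Longrightarrow> x \<otimes> x \<in> powers G 2"
  by (auto simp: powers_def numeral_2_eq_2 intro!: image_eqI[of _ _ x])

text \<open>Additively, if g = 1 + w modulo 2, then g^2 = 1 + 2w + w^2, and the cross term 2w
  vanishes modulo 2. The error term of the inner application stays in \<open>powers G 2\<close>
  because endomorphisms preserve that subgroup.\<close>

lemma square_hom_cong:
  assumes g: "g \<in> hom G G" and w: "w \<in> hom G G"
    and gw: "\<And>x. x \<in> carrier G \<Longrightarrow> \<exists>t\<in>powers G 2. g x = x \<otimes> w x \<otimes> t"
    and x: "x \<in> carrier G"
  shows "\<exists>t\<in>powers G 2. g (g x) = x \<otimes> w (w x) \<otimes> t"
proof -
  interpret T: subgroup "powers G 2" G by (rule subgroup_powers)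
  have cl [simp]: "\<And>y. y \<in> carrier G \<Longrightarrow> w y \<in> carrier G" "\<And>y. y \<in> carrier G \<Longrightarrow> g y \<in> carrier G"
    using w g by (auto simp: hom_in_carrier)
  obtain t where t: "t \<in> powers G 2" "g x = x \<otimes> w x \<otimes> t" using gw x by blast
  obtain s where s: "s \<in> powers G 2" "g (w x) = w x \<otimes> w (w x) \<otimes> s" using gw x by (meson cl)
  have [simp]: "t \<in> carrier G" "s \<in> carrier G" using t s T.subset by auto
  have gt: "g t \<in> powers G 2" by (rule powers_hom[OF g t(1)])
  have "g (g x) = g x \<otimes> g (w x) \<otimes> g t"
    using hom_mult[OF g] x by (subst t(2)) simp
  also have "\<dots> = x \<otimes> w (w x) \<otimes> ((w x \<otimes> w x) \<otimes> t \<otimes> s \<otimes> g t)"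
    using x by (simp add: t(2) s(2) m_ac)
  finally show ?thesis
    using t s gt square_in_powers[of "w x"] x by (metis T.m_closed cl(1))
qed

end

section \<open>Affine maps and their linear parts modulo 2\<close>

locale affine_map = comm_group G for G (structure) +
  fixes f :: "'a \<Rightarrow> 'a" and a :: 'a
  assumes f_hom: "f \<in> hom G G" and a_closed [simp, intro]: "a \<in> carrier G"
begin

definition p :: "'a \<Rightarrow> 'a" where "p x = a \<otimes> f x"
definition u :: "'a \<Rightarrow> 'a" where "u x = f x \<otimes> inv x"

lemma f_closed [simp, intro]: "x \<in> carrier G \<Longrightarrow> f x \<in> carrier G"
  using f_hom by (simp add: hom_in_carrier)

lemma f_mult: "x \<in> carrier G \<Longrightarrow> y \<in> carrier G \<Longrightarrow> f (x \<otimes> y) = f x \<otimes> f y"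
  using f_hom by (simp add: hom_mult)

lemma p_closed [simp, intro]: "x \<in> carrier G \<Longrightarrow> p x \<in> carrier G"
  by (simp add: p_def)

lemma u_hom: "u \<in> hom G G"
  by (rule homI) (simp_all add: u_def f_mult inv_mult m_ac)

lemma funpow_f_closed [simp, intro]: "x \<in> carrier G \<Longrightarrow> (f ^^ m) x \<in> carrier G"
  using hom_in_carrier[OF funpow_hom[OF f_hom]] .

lemma funpow_u_closed [simp, intro]: "x \<in> carrier G \<Longrightarrow> (u ^^ m) x \<in> carrier G"
  using hom_in_carrier[OF funpow_hom[OF u_hom]] .

lemma funpow_p_closed [simp, intro]: "x \<in> carrier G \<Longrightarrow> (p ^^ m) x \<in> carrier G"
  by (induction m) auto

lemma p_mult: "x \<in> carrier G \<Longrightarrow> y \<in> carrier G \<Longrightarrow> p (x \<otimes> y) = p x \<otimes> f y"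
  by (simp add: p_def f_mult m_assoc)

text \<open>Splits an iterate into its translation part and its linear part, so that the congruences
  for the two can be proved separately.\<close>

lemma funpow_p: "x \<in> carrier G \<Longrightarrow> (p ^^ m) x = (p ^^ m) \<one> \<otimes> (f ^^ m) x"
proof (induction m)
  case (Suc m)
  then show ?case by (simp add: p_mult)
qed simp

text \<open>This is \<open>(1 + u)\<^bsup>2^s\<^esup> = 1 + u\<^bsup>2^s\<^esup>\<close> modulo 2, in multiplicative notation.\<close>

lemma funpow_f_cong:
  "x \<in> carrier G \<Longrightarrow> \<exists>t\<in>powers G 2. (f ^^ (2 ^ s)) x = x \<otimes> (u ^^ (2 ^ s)) x \<otimes> t"
proof (induction s arbitrary: x)
  case 0
  have "f x = x \<otimes> u x \<otimes> \<one>" using 0 by (simp add: u_def mult_div_cancel)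
  then show ?case
    using subgroup.one_closed[OF subgroup_powers] by (auto intro!: bexI[of _ \<one>])
next
  case (Suc s)
  have "\<exists>t\<in>powers G 2. (f ^^ 2 ^ s) ((f ^^ 2 ^ s) x) = x \<otimes> (u ^^ 2 ^ s) ((u ^^ 2 ^ s) x) \<otimes> t"
    by (rule square_hom_cong[OF funpow_hom[OF f_hom] funpow_hom[OF u_hom] Suc.IH Suc.prems])
  then show ?case by (simp add: mult_2 funpow_add)
qed

text \<open>Additively p^m(0) = (1 + f + ... + f^(m-1))(a), and for m = 2^s the sum is u^(m-1)
  modulo 2. The induction doubles m: with b = p^m(0), p^(2m)(0) = b + f^m(b), which is u^m(b) modulo
  2.\<close>

lemma funpow_p_one_cong: "\<exists>t\<in>powers G 2. (p ^^ (2 ^ s)) \<one> = (u ^^ (2 ^ s - 1)) a \<otimes> t"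
proof (induction s)
  case 0
  have "f \<one> = \<one>" using hom_one[OF f_hom is_group is_group] .
  then have "p \<one> = a \<otimes> \<one>" by (simp add: p_def)
  then show ?case
    using subgroup.one_closed[OF subgroup_powers] by (auto intro!: bexI[of _ \<one>])
next
  case (Suc s)
  interpret T: subgroup "powers G 2" G by (rule subgroup_powers)
  define b where "b = (p ^^ (2 ^ s)) \<one>"
  have b [simp]: "b \<in> carrier G" by (simp add: b_def)
  obtain t where t: "t \<in> powers G 2" "b = (u ^^ (2 ^ s - 1)) a \<otimes> t"
    using Suc.IH by (auto simp: b_def)
  obtain r where r: "r \<in> powers G 2" "(f ^^ (2 ^ s)) b = b \<otimes> (u ^^ (2 ^ s)) b \<otimes> r"
    using funpow_f_cong[OF b] by blast
  have [simp]: "t \<in> carrier G" "r \<in> carrier G" using t r T.subset by auto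
  have ut: "(u ^^ 2 ^ s) t \<in> powers G 2" by (rule powers_hom[OF funpow_hom[OF u_hom] t(1)])
  have "(u ^^ (2 ^ s)) b = (u ^^ 2 ^ s) ((u ^^ (2 ^ s - 1)) a) \<otimes> (u ^^ 2 ^ s) t"
    by (simp add: t(2) hom_mult[OF funpow_hom[OF u_hom]])
  also have "(u ^^ 2 ^ s) ((u ^^ (2 ^ s - 1)) a) = (u ^^ (2 ^ Suc s - 1)) a"
  proof -
    have "(2::nat) ^ Suc s - 1 = 2 ^ s + (2 ^ s - 1)" by simp
    then show ?thesis by (metis comp_apply funpow_add)
  qed
  finally have ub: "(u ^^ (2 ^ s)) b = (u ^^ (2 ^ Suc s - 1)) a \<otimes> (u ^^ 2 ^ s) t" .
  have "(p ^^ (2 ^ Suc s)) \<one> = (p ^^ 2 ^ s) b"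
    by (simp add: b_def mult_2 funpow_add)
  also have "\<dots> = b \<otimes> (f ^^ 2 ^ s) b"
    using funpow_p[OF b] by (simp add: b_def)
  also have "\<dots> = (u ^^ (2 ^ Suc s - 1)) a \<otimes> ((b \<otimes> b) \<otimes> (u ^^ 2 ^ s) t \<otimes> r)"
    unfolding r(2) ub by (simp add: m_ac del: power_Suc)
  finally show ?case
    using r(1) ut square_in_powers[OF b] by (metis T.m_closed)
qed

text \<open>The preimages in \<open>G\<close> of the images of the powers of \<open>u\<close> modulo 2; they decrease strictly until
  they reach \<open>powers G 2\<close>.\<close>

definition V :: "nat \<Rightarrow> 'a set" where
  "V i = {(u ^^ i) z \<otimes> t | z t. z \<in> carrier G \<and> t \<in> powers G 2}"

lemma V_subgroup: "subgroup (V i) G"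
proof -
  interpret T: subgroup "powers G 2" G by (rule subgroup_powers)
  interpret h: group_hom G G "u ^^ i"
    using funpow_hom[OF u_hom] by unfold_locales
  show ?thesis
  proof (rule subgroupI)
    show "V i \<subseteq> carrier G" by (auto simp: V_def)
    show "V i \<noteq> {}" using T.one_closed one_closed unfolding V_def by blast
  next
    fix x assume "x \<in> V i"
    then obtain z t where zt: "x = (u ^^ i) z \<otimes> t" "z \<in> carrier G" "t \<in> powers G 2"
      by (auto simp: V_def)
    then have "inv x = (u ^^ i) (inv z) \<otimes> inv t"
      by (simp add: inv_mult)
    then show "inv x \<in> V i" using zt unfolding V_def
      by (intro CollectI exI[of _ "inv z"] exI[of _ "inv t"]) simp
  next
    fix x y assume "x \<in> V i" "y \<in> V i"
    then obtain z t z' t' where zt: "x = (u ^^ i) z \<otimes> t" "z \<in> carrier G" "t \<in> powers G 2"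
      "y = (u ^^ i) z' \<otimes> t'" "z' \<in> carrier G" "t' \<in> powers G 2"
      by (auto simp: V_def)
    then have "x \<otimes> y = (u ^^ i) (z \<otimes> z') \<otimes> (t \<otimes> t')"
      by (simp add: m_ac)
    then show "x \<otimes> y \<in> V i" using zt unfolding V_def
      by (intro CollectI exI[of _ "z \<otimes> z'"] exI[of _ "t \<otimes> t'"]) simp
  qed
qed

lemma V_Suc_subset: "V (Suc i) \<subseteq> V i"
  unfolding V_def
  by clarify (metis funpow_swap1 funpow.simps(2) comp_apply hom_in_carrier[OF u_hom])

lemma powers_subset_V: "powers G 2 \<subseteq> V i"
proof
  interpret T: subgroup "powers G 2" G by (rule subgroup_powers)
  interpret h: group_hom G G "u ^^ i"
    using funpow_hom[OF u_hom] by unfold_locales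
  fix t assume "t \<in> powers G 2"
  then show "t \<in> V i" unfolding V_def by (intro CollectI exI[of _ \<one>] exI[of _ t]) simp
qed

text \<open>Each term of the chain is determined by the preceding one alone, so a single repetition
  makes the chain constant from there on.\<close>

lemma V_Suc_eq: "V (Suc i) = {u y \<otimes> t | y t. y \<in> V i \<and> t \<in> powers G 2}"
proof (intro subset_antisym subsetI)
  interpret T: subgroup "powers G 2" G by (rule subgroup_powers)
  fix x assume "x \<in> V (Suc i)"
  then obtain z t where zt: "x = u ((u ^^ i) z) \<otimes> t" "z \<in> carrier G" "t \<in> powers G 2"
    by (auto simp: V_def)
  moreover have "(u ^^ i) z \<in> V i"
    using zt T.one_closed unfolding V_def by (intro CollectI exI[of _ z] exI[of _ \<one>]) simp
  ultimately show "x \<in> {u y \<otimes> t | y t. y \<in> V i \<and> t \<in> powers G 2}" by blast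
next
  interpret T: subgroup "powers G 2" G by (rule subgroup_powers)
  fix x assume "x \<in> {u y \<otimes> t | y t. y \<in> V i \<and> t \<in> powers G 2}"
  then obtain z t s where zt: "x = u ((u ^^ i) z \<otimes> s) \<otimes> t" "z \<in> carrier G" "t \<in> powers G 2"
    "s \<in> powers G 2"
    by (auto simp: V_def)
  have "u s \<in> powers G 2" using powers_hom[OF u_hom] zt by blast
  moreover from this have "x = (u ^^ Suc i) z \<otimes> (u s \<otimes> t)"
    using zt hom_mult[OF u_hom] hom_in_carrier[OF u_hom] by (simp add: m_assoc)
  ultimately show "x \<in> V (Suc i)" using zt unfolding V_def by blast
qed

lemma V_stable:
  assumes "V (Suc i) = V i" shows "V (i + j) = V i"
proof (induction j)
  case (Suc j)
  then show ?case using V_Suc_eq[of "i + j"] V_Suc_eq[of i] assms by simp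
qed simp

text \<open>The linear part of p^(2^S) = 1 is f^(2^S) = 1, so u^(2^S) vanishes modulo 2 by the
  congruence for f^(2^S).\<close>

lemma V_limit:
  assumes "\<And>x. x \<in> carrier G \<Longrightarrow> (p ^^ (2 ^ S)) x = x"
  shows "V (2 ^ S) = powers G 2"
proof (rule subset_antisym[OF _ powers_subset_V])
  interpret T: subgroup "powers G 2" G by (rule subgroup_powers)
  show "V (2 ^ S) \<subseteq> powers G 2"
  proof
    fix x assume "x \<in> V (2 ^ S)"
    then obtain z t where zt: "x = (u ^^ 2 ^ S) z \<otimes> t" "z \<in> carrier G" "t \<in> powers G 2"
      by (auto simp: V_def)
    obtain r where r: "r \<in> powers G 2" "(f ^^ (2 ^ S)) z = z \<otimes> (u ^^ (2 ^ S)) z \<otimes> r"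
      using funpow_f_cong zt by blast
    have "(f ^^ 2 ^ S) z = z"
      using funpow_p[OF zt(2), of "2 ^ S"] assms zt by simp
    then have "z \<otimes> ((u ^^ (2 ^ S)) z \<otimes> r) = z \<otimes> \<one>"
      using r zt by (simp add: m_assoc)
    then have "(u ^^ (2 ^ S)) z \<otimes> r = \<one>"
      using r(1) zt(2) by (simp only: Units_eq Units_l_cancel funpow_u_closed T.mem_carrier m_closed one_closed)
    then have "(u ^^ (2 ^ S)) z = inv r"
      using r(1) zt inv_equality by force
    then show "x \<in> powers G 2" using zt r by auto
  qed
qed

text \<open>By Lagrange, each strict step of the chain at least halves the order, and the chain can
  become constant only at \<open>powers G 2\<close>.\<close>

lemma V_card:
  assumes "finite (carrier G)" and "\<And>x. x \<in> carrier G \<Longrightarrow> (p ^^ (2 ^ S)) x = x"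
  shows "V i = powers G 2 \<or> card (V i) * 2 ^ i \<le> order G"
proof (induction i)
  case 0
  have "card (V 0) \<le> order G"
    unfolding order_def by (rule card_mono[OF assms(1) subgroup.subset[OF V_subgroup]])
  then show ?case by simp
next
  case (Suc i)
  have fin: "finite (V i)" using assms(1) subgroup.subset[OF V_subgroup] finite_subset by blast
  show ?case
  proof (cases "V (Suc i) = V i")
    case True
    \<comment> \<open>The chain is constant from 2^S on, being squeezed against
      \<open>powers G 2\<close>; it is also constant from \<open>i\<close> on, so the two constant
      values agree.\<close>
    have "V (i + 2 ^ S) = V (2 ^ S)"
      using V_stable[of "2 ^ S" i] V_Suc_subset powers_subset_V V_limit[OF assms(2)]
      by (simp add: add.commute) blast
    then show ?thesis using V_stable[OF True] True V_limit[OF assms(2)] by simp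
  next
    case False
    then have ps: "V (Suc i) \<subset> V i" using V_Suc_subset by blast
    then have "V i \<noteq> powers G 2" using powers_subset_V[of "Suc i"] by blast
    then have IH: "card (V i) * 2 ^ i \<le> order G" using Suc.IH by blast
    interpret Vi: group "G\<lparr>carrier := V i\<rparr>"
      by (rule subgroup.subgroup_is_group[OF V_subgroup is_group])
    have "subgroup (V (Suc i)) (G\<lparr>carrier := V i\<rparr>)"
      by (rule subgroup_incl[OF V_subgroup V_subgroup V_Suc_subset])
    from Vi.lagrange[OF this] obtain c where c: "c * card (V (Suc i)) = card (V i)"
      by (auto simp: order_def)
    have "card (V (Suc i)) < card (V i)" by (rule psubset_card_mono[OF fin ps])
    then have "c \<noteq> 0" "c \<noteq> 1" using c by (metis less_nat_zero_code mult_0, fastforce)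
    then have "2 \<le> c" by linarith
    then have "2 * card (V (Suc i)) \<le> card (V i)" using c mult_le_mono1 by metis
    then have "card (V (Suc i)) * 2 ^ Suc i \<le> card (V i) * 2 ^ i" by simp
    then show ?thesis using IH order_trans by blast
  qed
qed

text \<open>Here 2^r is the index of 2N. At i = r the size bound leaves \<open>V r\<close> no more
  elements than its subset \<open>powers G 2\<close>.\<close>

lemma u_nilpotent_mod_2:
  assumes fin: "finite (carrier G)" and p: "\<And>x. x \<in> carrier G \<Longrightarrow> (p ^^ (2 ^ S)) x = x"
    and r: "order G = 2 ^ r * card (powers G 2)" and x: "x \<in> carrier G" and "r \<le> i"
  shows "(u ^^ i) x \<in> powers G 2"
proof -
  interpret T: subgroup "powers G 2" G by (rule subgroup_powers)
  have "V r = powers G 2"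
  proof -
    have "card (V r) * 2 ^ r \<le> card (powers G 2) * 2 ^ r \<Longrightarrow> V r = powers G 2"
      using card_seteq[of "V r" "powers G 2"] powers_subset_V
        finite_subset[OF subgroup.subset[OF V_subgroup] fin] by simp
    then show ?thesis using V_card[OF fin p, of r] r by (auto simp: mult_ac)
  qed
  moreover have "V i \<subseteq> V r"
    using lift_Suc_antimono_le[of V, OF V_Suc_subset \<open>r \<le> i\<close>] .
  moreover have "(u ^^ i) x \<in> V i"
    using x T.one_closed unfolding V_def by (intro CollectI exI[of _ x] exI[of _ \<one>]) simp
  ultimately show ?thesis by blast
qed

text \<open>The form of the bound on \<open>r\<close> comes from the translation part, which
  involves u to the power 2^k - 1; the linear part involves the larger power 2^k.\<close>

lemma funpow_p_mod_2:
  assumes fin: "finite (carrier G)" and p: "\<And>x. x \<in> carrier G \<Longrightarrow> (p ^^ (2 ^ S)) x = x"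
    and r: "order G = 2 ^ r * card (powers G 2)" and k: "r + 1 \<le> 2 ^ k"
  shows "(p ^^ 2 ^ k) \<one> \<in> powers G 2"
    and "\<And>x. x \<in> carrier G \<Longrightarrow> \<exists>t\<in>powers G 2. (f ^^ 2 ^ k) x = x \<otimes> t"
proof -
  interpret T: subgroup "powers G 2" G by (rule subgroup_powers)
  have *: "(u ^^ i) x \<in> powers G 2" if "x \<in> carrier G" "r \<le> i" for x i
    using u_nilpotent_mod_2[OF fin p r that] .
  show "(p ^^ 2 ^ k) \<one> \<in> powers G 2"
    using funpow_p_one_cong[of k] *[of a "2 ^ k - 1"] k by auto
  fix x assume x: "x \<in> carrier G"
  obtain t where "t\<in>powers G 2" "(f ^^ (2 ^ k)) x = x \<otimes> (u ^^ (2 ^ k)) x \<otimes> t"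
    using funpow_f_cong[OF x] by blast
  then show "\<exists>t\<in>powers G 2. (f ^^ 2 ^ k) x = x \<otimes> t"
    using *[OF x, of "2 ^ k"] k x by (intro bexI[of _ "(u ^^ (2 ^ k)) x \<otimes> t"]) (auto simp: m_assoc)
qed

text \<open>Let f^M = 1 + w, where the image of w and b = p^M(0) lie in 2^(j+1)N. Then f^(2M) = 1 +
  2w + w^2 and p^(2M)(0) = 2b + w(b), and all of 2w, w^2, 2b and w(b) land in 2^(j+2)N.\<close>

lemma funpow_p_mod_2_power:
  assumes b: "(p ^^ m) \<one> \<in> powers G 2"
    and g: "\<And>x. x \<in> carrier G \<Longrightarrow> \<exists>t\<in>powers G 2. (f ^^ m) x = x \<otimes> t"
  shows "(p ^^ (m * 2 ^ j)) \<one> \<in> powers G (2 ^ Suc j)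
    \<and> (\<forall>x\<in>carrier G. \<exists>t\<in>powers G (2 ^ Suc j). (f ^^ (m * 2 ^ j)) x = x \<otimes> t)"
proof (induction j)
  case 0
  then show ?case using assms by simp
next
  case (Suc j)
  define M where "M = m * 2 ^ j"
  define w where "w x = (f ^^ M) x \<otimes> inv x" for x
  define b where "b = (p ^^ M) \<one>"
  interpret T: subgroup "powers G (2 ^ Suc j)" G by (rule subgroup_powers)
  interpret T': subgroup "powers G (2 ^ Suc (Suc j))" G by (rule subgroup_powers)
  have w_hom: "w \<in> hom G G"
    using hom_mult[OF funpow_hom[OF f_hom]] by (intro homI) (simp_all add: w_def inv_mult m_ac)
  have w_cl [simp]: "x \<in> carrier G \<Longrightarrow> w x \<in> carrier G" for x by (simp add: w_def)
  have f_w: "(f ^^ M) x = x \<otimes> w x" if "x \<in> carrier G" for x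
    using that by (simp add: w_def mult_div_cancel)
  have w_in: "w x \<in> powers G (2 ^ Suc j)" if x: "x \<in> carrier G" for x
  proof -
    obtain t where "t \<in> powers G (2 ^ Suc j)" "(f ^^ M) x = x \<otimes> t"
      using Suc.IH x by (auto simp: M_def)
    moreover from this have "w x = t"
      using x T.mem_carrier m_comm[of x t] by (simp add: w_def m_assoc)
    ultimately show ?thesis by simp
  qed
  \<comment> \<open>Being additive, \<open>w\<close> sends 2^(j+1) y to 2^(j+1) w(y), which lies in
    2^(2j+2)N, and 2j + 2 \<ge> j + 2.\<close>
  have ww: "w x \<in> powers G (2 ^ Suc (Suc j))" if x: "x \<in> powers G (2 ^ Suc j)" for x
  proof -
    obtain y where y: "y \<in> carrier G" "x = y [^] (2 ^ Suc j :: nat)"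
      using x unfolding powers_def by blast
    have "w x = w y [^] (2 ^ Suc j :: nat)"
      using hom_nat_pow[OF w_hom y(1) is_group is_group] y by simp
    then have "w x \<in> powers G (2 ^ Suc j * 2 ^ Suc j)"
      using powers_mult_exp[OF w_in[OF y(1)], of "2 ^ Suc j"] by (simp only:)
    moreover have "(2::nat) ^ Suc (Suc j) dvd 2 ^ Suc j * 2 ^ Suc j"
      unfolding power_add[symmetric] by (rule le_imp_power_dvd) simp
    ultimately show ?thesis
      using powers_dvd by blast
  qed
  have sq: "x \<otimes> x \<in> powers G (2 ^ Suc (Suc j))" if x: "x \<in> powers G (2 ^ Suc j)" for x
    using powers_mult_exp[OF x, of 2] T.subset x
    by (auto simp: numeral_2_eq_2 mult_ac)
  have b_in: "b \<in> powers G (2 ^ Suc j)" using Suc.IH by (simp add: b_def M_def)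
  then have [simp]: "b \<in> carrier G" using T.subset by blast
  have M2: "m * 2 ^ Suc j = M + M" by (simp add: M_def)
  have "(p ^^ (m * 2 ^ Suc j)) \<one> = (p ^^ M) b"
    unfolding M2 by (simp add: b_def funpow_add)
  also have "\<dots> = b \<otimes> (f ^^ M) b" using funpow_p[of b M] by (simp add: b_def)
  also have "\<dots> = (b \<otimes> b) \<otimes> w b" by (simp add: f_w m_assoc)
  finally have 1: "(p ^^ (m * 2 ^ Suc j)) \<one> \<in> powers G (2 ^ Suc (Suc j))"
    using sq[OF b_in] ww[OF b_in] by (metis T'.m_closed)
  have 2: "\<exists>t\<in>powers G (2 ^ Suc (Suc j)). (f ^^ (m * 2 ^ Suc j)) x = x \<otimes> t"
    if x: "x \<in> carrier G" for x
  proof -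
    have "(f ^^ (m * 2 ^ Suc j)) x = (f ^^ M) ((f ^^ M) x)"
      unfolding M2 by (simp add: funpow_add)
    also have "\<dots> = x \<otimes> (w x \<otimes> w x \<otimes> w (w x))"
      using x by (simp add: f_w hom_mult[OF w_hom] m_ac)
    finally show ?thesis
      using sq[OF w_in[OF x]] ww[OF w_in[OF x]] by (metis T'.m_closed)
  qed
  show ?case using 1 2 by blast
qed

text \<open>With K = 2^(k+j), the map p^K sends T = 2^(j+1)N into itself. As the orbit starts in T,
  it is covered by the K images p^i(T) with i < K.\<close>

lemma orbit_bound:
  assumes fin: "finite (carrier G)" and p: "\<And>x. x \<in> carrier G \<Longrightarrow> (p ^^ (2 ^ S)) x = x"
    and r: "order G = 2 ^ r * card (powers G 2)" and k: "r + 1 \<le> 2 ^ k"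
  shows "card (range (\<lambda>i. (p ^^ i) \<one>)) \<le> 2 ^ (k + j) * card (powers G (2 ^ Suc j))"
proof -
  let ?K = "2 ^ k * 2 ^ j :: nat" and ?T = "powers G (2 ^ Suc j)"
  interpret T: subgroup ?T G by (rule subgroup_powers)
  have finT: "finite ?T" using T.subset fin finite_subset by blast
  have K: "(p ^^ ?K) \<one> \<in> ?T" "\<And>x. x \<in> carrier G \<Longrightarrow> \<exists>t\<in>?T. (f ^^ ?K) x = x \<otimes> t"
    using funpow_p_mod_2_power[OF funpow_p_mod_2[OF fin p r k], of j] by auto
  have step: "(p ^^ ?K) x \<in> ?T" if x: "x \<in> ?T" for x
  proof -
    have xc: "x \<in> carrier G" using x T.subset by blast
    obtain t where "t \<in> ?T" "(f ^^ ?K) x = x \<otimes> t" using K(2)[OF xc] by blast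
    then show ?thesis using funpow_p[OF xc, of ?K] K(1) x by (metis T.m_closed)
  qed
  have one_in: "\<one> \<in> ?T" by (rule T.one_closed)
  have mult: "(p ^^ (?K * q)) \<one> \<in> ?T" for q
  proof (induction q)
    case (Suc q)
    then show ?case using step by (simp add: funpow_add del: funpow.simps)
  qed (simp only: mult_0_right funpow.simps id_apply one_in)
  have "range (\<lambda>i. (p ^^ i) \<one>) \<subseteq> (\<Union>i<?K. (p ^^ i) ` ?T)"
  proof clarify
    fix i
    have "(p ^^ i) \<one> = (p ^^ (i mod ?K)) ((p ^^ (?K * (i div ?K))) \<one>)"
      by (metis comp_apply funpow_add mod_mult_div_eq)
    then show "(p ^^ i) \<one> \<in> (\<Union>i<?K. (p ^^ i) ` ?T)"
      using mult by (intro UN_I[of "i mod ?K"]) auto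
  qed
  then have "card (range (\<lambda>i. (p ^^ i) \<one>)) \<le> card (\<Union>i<?K. (p ^^ i) ` ?T)"
    using finT by (intro card_mono) auto
  also have "\<dots> \<le> (\<Sum>i<?K. card ((p ^^ i) ` ?T))"
    by (rule card_UN_le) simp
  also have "\<dots> \<le> (\<Sum>i<?K. card ?T)"
    by (intro sum_mono card_image_le finT)
  finally show ?thesis by (simp add: power_add)
qed

end

section \<open>Splitting off cyclic factors\<close>

context comm_group
begin

text \<open>As y^2 lies in \<open>H\<close>, adjoining \<open>y\<close> adds only the coset yH;
  inverses come from y^(-1) = y (y^2)^(-1). This is the enlargement in the maximality argument
  below.\<close>

lemma subgroup_extend_square:
  assumes "subgroup H G" and y: "y \<in> carrier G" and yy: "y \<otimes> y \<in> H"
  shows "subgroup (H \<union> (\<lambda>h. y \<otimes> h) ` H) G"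
proof -
  interpret H: subgroup H G by fact
  show ?thesis
  proof (rule subgroupI)
    show "H \<union> (\<lambda>h. y \<otimes> h) ` H \<subseteq> carrier G" using y by auto
    show "H \<union> (\<lambda>h. y \<otimes> h) ` H \<noteq> {}" using H.one_closed by blast
  next
    fix x assume "x \<in> H \<union> (\<lambda>h. y \<otimes> h) ` H"
    then consider "x \<in> H" | h where "x = y \<otimes> h" "h \<in> H" by blast
    then show "inv x \<in> H \<union> (\<lambda>h. y \<otimes> h) ` H"
    proof cases
      case 2
      have "inv x = y \<otimes> (inv (y \<otimes> y) \<otimes> inv h)"
        using 2 y by (simp add: inv_mult m_assoc[symmetric])
      then show ?thesis using 2 yy by blast
    qed simp
  next
    fix x x' assume "x \<in> H \<union> (\<lambda>h. y \<otimes> h) ` H" "x' \<in> H \<union> (\<lambda>h. y \<otimes> h) ` H"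
    then consider "x \<in> H" "x' \<in> H" | h where "x = y \<otimes> h" "h \<in> H" "x' \<in> H"
      | h where "x \<in> H" "x' = y \<otimes> h" "h \<in> H"
      | h h' where "x = y \<otimes> h" "h \<in> H" "x' = y \<otimes> h'" "h' \<in> H"
      by blast
    then show "x \<otimes> x' \<in> H \<union> (\<lambda>h. y \<otimes> h) ` H"
    proof cases
      case (2 h)
      then have "x \<otimes> x' = y \<otimes> (h \<otimes> x')" using y by (simp add: m_assoc)
      then show ?thesis using 2 by blast
    next
      case (3 h)
      then have "x \<otimes> x' = y \<otimes> (x \<otimes> h)" using y by (simp add: m_lcomm)
      then show ?thesis using 3 by blast
    next
      case (4 h h')
      then have "x \<otimes> x' = (y \<otimes> y) \<otimes> (h \<otimes> h')" using y by (simp add: m_ac)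
      then show ?thesis using 4 yy by (metis H.m_closed UnI1)
    qed simp
  qed
qed

text \<open>The complement is a subgroup \<open>H\<close> maximal among those meeting the cyclic group of \<open>g\<close> trivially. If
  it were not one, some \<open>x\<close> outside the product has its square inside; the order of \<open>g\<close> being maximal, \<open>x\<close>
  can be modified by a power of \<open>g\<close> so that its square lies in \<open>H\<close>, and then \<open>H\<close> can be enlarged.\<close>

lemma complement_of_max_order:
  assumes fin: "finite (carrier G)" and g: "g \<in> carrier G" and ord: "ord g = 2 ^ Suc k"
    and expo: "\<And>x. x \<in> carrier G \<Longrightarrow> x [^] (2 ^ Suc k :: nat) = \<one>"
  shows "\<exists>H. subgroup H G \<and> H \<inter> range (\<lambda>i::int. g [^] i) = {\<one>} \<and>
    carrier G \<subseteq> {g [^] i \<otimes> h | (i::int) h. h \<in> H}"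
proof -
  define C where "C = range (\<lambda>i::int. g [^] i)"
  interpret C: subgroup C G unfolding C_def by (rule subgroup_of_powers[OF g])
  let ?\<H> = "{H. subgroup H G \<and> H \<inter> C = {\<one>}}"
  have "?\<H> \<subseteq> Pow (carrier G)" using subgroup.subset by blast
  then have "finite ?\<H>" using fin by (meson finite_Pow_iff finite_subset)
  moreover have "{\<one>} \<in> ?\<H>" using triv_subgroup by auto
  ultimately obtain H where H: "H \<in> ?\<H>" and H_max: "\<And>H'. H' \<in> ?\<H> \<Longrightarrow> H \<subseteq> H' \<Longrightarrow> H' = H"
    using finite_has_maximal[of ?\<H>] by (metis (no_types, lifting) empty_iff)
  interpret H: subgroup H G using H by blast
  have HC: "H \<inter> C = {\<one>}" using H by blast
  define D where "D = {g [^] i \<otimes> h | (i::int) h. h \<in> H}"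
  have "carrier G \<subseteq> D"
  proof (rule ccontr)
    assume "\<not> carrier G \<subseteq> D"
    then obtain z where z: "z \<in> carrier G" "z \<notin> D" by blast
    have "\<one> \<in> D" using H.one_closed unfolding D_def by (intro CollectI exI[of _ 0] exI[of _ \<one>]) simp
    \<comment> \<open>The last repeated square of \<open>z\<close> before \<open>D\<close> is
      entered is the element \<open>x\<close> sought: it lies outside \<open>D\<close> and its
      square inside.\<close>
    define m where "m = (LEAST m. z [^] (2 ^ m :: nat) \<in> D)"
    have m: "z [^] (2 ^ m :: nat) \<in> D"
      unfolding m_def by (rule LeastI[of _ "Suc k"]) (use expo[OF z(1)] \<open>\<one> \<in> D\<close> in simp)
    have "m \<noteq> 0" using m z by (intro notI) simp
    then obtain l where l: "m = Suc l" using not0_implies_Suc by blast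
    define x where "x = z [^] (2 ^ l :: nat)"
    have x: "x \<in> carrier G" "x \<notin> D"
      using not_less_Least[of l "\<lambda>m. z [^] (2 ^ m :: nat) \<in> D"] z l by (auto simp: x_def m_def)
    have "x \<otimes> x = z [^] (2 ^ m :: nat)"
      using z by (simp add: x_def l nat_pow_mult mult_2)
    then obtain i :: int and h where ih: "x \<otimes> x = g [^] i \<otimes> h" "h \<in> H"
      using m unfolding D_def by auto
    \<comment> \<open>Raising x^2 = g^i h to the power 2^k gives 1, so g^(i 2^k) lies in both
      \<open>H\<close> and \<open>C\<close> and is trivial. As \<open>g\<close> has order 2^(k+1),
      \<open>i\<close> is even, and dividing \<open>x\<close> by g^(i/2) leaves an element with
      square \<open>h\<close>.\<close>
    have "(x \<otimes> x) [^] (2 ^ k :: nat) = x [^] (2 ^ Suc k :: nat)"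
      using x by (simp add: nat_pow_distrib nat_pow_mult mult_2)
    then have "(g [^] i) [^] (2 ^ k :: nat) \<otimes> h [^] (2 ^ k :: nat) = \<one>"
      using expo[OF x(1)] ih g by (simp add: nat_pow_distrib)
    then have eq: "(g [^] i) [^] (2 ^ k :: nat) = inv (h [^] (2 ^ k :: nat))"
      using g ih inv_equality[of "(g [^] i) [^] (2 ^ k :: nat)" "h [^] (2 ^ k :: nat)"] by simp
    have pow: "(g [^] i) [^] (2 ^ k :: nat) = g [^] (i * 2 ^ k)"
      using int_pow_pow[OF g, of i "int (2 ^ k)"] unfolding int_pow_int by simp
    have hk: "h [^] m \<in> H" for m :: nat
      using ih by (induction m) auto
    have "g [^] (i * 2 ^ k) \<in> H"
      using eq pow hk by (metis H.m_inv_closed)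
    moreover have "g [^] (i * 2 ^ k) \<in> C"
      unfolding C_def by (rule rangeI)
    ultimately have "g [^] (i * 2 ^ k) \<in> H \<inter> C" by blast
    then have "g [^] (i * 2 ^ k) = \<one>" using HC by blast
    then have "int (2 ^ Suc k) dvd i * 2 ^ k" using int_pow_eq_id[OF g] ord by metis
    then have "even i" by simp
    then obtain j where j: "i = j + j" by (metis evenE mult_2)
    define y where "y = x \<otimes> inv (g [^] j)"
    have y: "y \<in> carrier G" using x g by (simp add: y_def)
    have x_y: "x = g [^] j \<otimes> y" using x g by (simp add: y_def mult_div_cancel)
    have "g [^] i = g [^] j \<otimes> g [^] j"
      unfolding j by (rule int_pow_mult[OF g])
    then have "g [^] i \<otimes> (y \<otimes> y) = x \<otimes> x"
      using y g by (simp add: x_y m_ac)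
    then have yy: "y \<otimes> y = h" using ih y g by simp
    have y_D: "y \<notin> D"
    proof
      assume "y \<in> D"
      then obtain i' :: int and h' where "y = g [^] i' \<otimes> h'" "h' \<in> H" by (auto simp: D_def)
      then have "x = g [^] (j + i') \<otimes> h'" using g by (simp add: x_y int_pow_mult m_assoc)
      then show False using x \<open>h' \<in> H\<close> by (auto simp: D_def)
    qed
    define H' where "H' = H \<union> (\<lambda>h. y \<otimes> h) ` H"
    have "subgroup H' G"
      unfolding H'_def by (rule subgroup_extend_square) (use H y yy ih in auto)
    moreover have "H' \<inter> C = {\<one>}"
    proof -
      have False if "h' \<in> H" "y \<otimes> h' = g [^] (i'::int)" for h' i'
      proof -
        have "g [^] i' \<otimes> inv h' = y \<otimes> (h' \<otimes> inv h')"
          using that y by (simp add: that(2)[symmetric] m_assoc)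
        then have "y = g [^] i' \<otimes> inv h'" using that y by simp
        then show False using y_D that unfolding D_def by blast
      qed
      then have "(\<lambda>h. y \<otimes> h) ` H \<inter> C = {}" by (auto simp: C_def)
      then show ?thesis using HC by (auto simp: H'_def)
    qed
    ultimately have "H' = H" by (intro H_max) (auto simp: H'_def)
    moreover have "y \<in> H'" using y H.one_closed unfolding H'_def by (intro UnI2 image_eqI[of _ _ \<one>]) simp_all
    moreover have "H \<subseteq> D" unfolding D_def
      by (intro subsetI CollectI exI[of _ 0]) (metis H.mem_carrier int_pow_0 l_one)
    ultimately show False using y_D by blast
  qed
  then show ?thesis using H HC unfolding C_def D_def by blast
qed

text \<open>2^k is the exponent: minimality of \<open>k\<close> yields an element of that order, and
  its complement gives an internal direct product. The clause on \<open>l\<close> later orders the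
  successive cyclic factors by size.\<close>

lemma two_group_split:
  assumes ord: "order G = 2 ^ n" and "n \<noteq> 0"
  shows "\<exists>k H. k \<noteq> 0 \<and> subgroup H G \<and> (\<forall>x\<in>carrier G. x [^] (2 ^ k :: nat) = \<one>) \<and>
    (\<forall>l. (\<forall>x\<in>carrier G. x [^] (2 ^ l :: nat) = \<one>) \<longrightarrow> k \<le> l) \<and>
    G \<cong> cyclic (2 ^ k) \<times>\<times> G\<lparr>carrier := H\<rparr>"
proof -
  have fin: "finite (carrier G)" using ord by (metis order_gt_0_iff_finite zero_less_numeral zero_less_power)
  let ?P = "\<lambda>k. \<forall>x\<in>carrier G. x [^] (2 ^ k :: nat) = \<one>"
  define k where "k = (LEAST k. ?P k)"
  have k: "?P k"
    unfolding k_def by (rule LeastI[of _ n]) (use pow_order_eq_1 ord in auto)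
  have k_min: "k \<le> l" if "?P l" for l
    unfolding k_def using Least_le[of ?P l] that by blast
  have "k \<noteq> 0"
  proof
    assume "k = 0"
    then have "carrier G = {\<one>}" using k by auto
    then have "2 ^ n = (1 :: nat)" using ord by (simp add: order_def)
    then show False using \<open>n \<noteq> 0\<close> one_less_power[of "2::nat" n] by simp
  qed
  then obtain k' where k': "k = Suc k'" using not0_implies_Suc by blast
  then obtain g where g: "g \<in> carrier G" "g [^] (2 ^ k' :: nat) \<noteq> \<one>"
    using not_less_Least[of k' ?P] by (auto simp: k_def)
  have "ord g dvd 2 ^ k" using k g pow_eq_id by blast
  then obtain j where j: "ord g = 2 ^ j" "j \<le> k" using divides_primepow_nat[OF two_is_prime_nat] by blast
  have "\<not> j \<le> k'" using g pow_eq_id[OF g(1)] j le_imp_power_dvd by metis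
  then have ord_g: "ord g = 2 ^ Suc k'" using j k' le_antisym by (simp add: not_less_eq_eq)
  obtain H where H: "subgroup H G" "H \<inter> range (\<lambda>i::int. g [^] i) = {\<one>}"
    "carrier G \<subseteq> {g [^] i \<otimes> h | (i::int) h. h \<in> H}"
    using complement_of_max_order[OF fin g(1) ord_g] k k' by blast
  interpret H: subgroup H G by fact
  define \<phi> where "\<phi> = (\<lambda>(i::int, h). g [^] i \<otimes> h)"
  \<comment> \<open>Addition in \<open>cyclic (2 ^ k)\<close> is reduced modulo 2^k; that \<phi>
    respects this rests on \<open>g\<close> having order 2^k.\<close>
  have pow_mod: "g [^] (i mod 2 ^ k) = g [^] i" for i :: int
    using int_pow_eq[OF g(1)] ord_g by (simp add: k' mod_eq_dvd_iff[symmetric])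
  have car: "carrier (cyclic (2 ^ k) \<times>\<times> G\<lparr>carrier := H\<rparr>) = {0..<2 ^ k} \<times> H"
    by (simp add: carrier_integer_mod_group)
  have "\<phi> \<in> iso (cyclic (2 ^ k) \<times>\<times> G\<lparr>carrier := H\<rparr>) G"
    unfolding iso_iff car
  proof (intro conjI)
    show "\<phi> \<in> hom (cyclic (2 ^ k) \<times>\<times> G\<lparr>carrier := H\<rparr>) G"
    proof (rule homI)
      fix x assume "x \<in> carrier (cyclic (2 ^ k) \<times>\<times> G\<lparr>carrier := H\<rparr>)"
      then show "\<phi> x \<in> carrier G" using g by (auto simp: \<phi>_def)
    next
      fix x y assume "x \<in> carrier (cyclic (2 ^ k) \<times>\<times> G\<lparr>carrier := H\<rparr>)"
        "y \<in> carrier (cyclic (2 ^ k) \<times>\<times> G\<lparr>carrier := H\<rparr>)"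
      then show "\<phi> (x \<otimes>\<^bsub>cyclic (2 ^ k) \<times>\<times> G\<lparr>carrier := H\<rparr>\<^esub> y) = \<phi> x \<otimes> \<phi> y"
        using g by (auto simp: \<phi>_def pow_mod int_pow_mult m_ac)
    qed
    show "\<phi> ` ({0..<2 ^ k} \<times> H) = carrier G"
    proof (intro subset_antisym subsetI)
      fix x assume "x \<in> carrier G"
      then obtain i :: int and h where ih: "x = g [^] i \<otimes> h" "h \<in> H" using H(3) by blast
      have "x = \<phi> (i mod 2 ^ k, h)" by (simp add: \<phi>_def pow_mod ih)
      then show "x \<in> \<phi> ` ({0..<2 ^ k} \<times> H)" using ih by auto
    qed (use g in \<open>auto simp: \<phi>_def\<close>)
    show "inj_on \<phi> ({0..<2 ^ k} \<times> H)"
    proof (rule inj_onI, clarify)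
      fix i j :: int and h h'
      assume i: "i \<in> {0..<2 ^ k}" and h: "h \<in> H" and j: "j \<in> {0..<2 ^ k}" and h': "h' \<in> H"
        and eq: "\<phi> (i, h) = \<phi> (j, h')"
      have eq: "g [^] i \<otimes> h = g [^] j \<otimes> h'" using eq by (simp add: \<phi>_def)
      \<comment> \<open>Equal images place h h'^(-1) in the intersection of \<open>H\<close> with
        the powers of \<open>g\<close>, which is trivial, so both coordinates agree.\<close>
      have "h \<otimes> inv h' = inv (g [^] i) \<otimes> ((g [^] i \<otimes> h) \<otimes> inv h')"
        using h h' g by (simp add: m_assoc[symmetric])
      also have "\<dots> = inv (g [^] i) \<otimes> g [^] j"
        unfolding eq using h h' g by (simp add: m_assoc)
      also have "\<dots> = g [^] (j - i)"
        using g by (simp add: int_pow_diff m_comm)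
      finally have eq': "h \<otimes> inv h' = g [^] (j - i)" .
      then have one: "g [^] (j - i) = \<one>" using H(2) h h' by (metis H.m_closed H.m_inv_closed IntI rangeI singletonD)
      then have "int (2 ^ k) dvd j - i" using int_pow_eq_id[OF g(1)] ord_g k' by metis
      then have "j mod 2 ^ k = i mod 2 ^ k" by (simp add: mod_eq_dvd_iff)
      then have "i = j" using i j by simp
      moreover have "h = h'" using eq' one h h' by (metis H.mem_carrier inv_equality inv_inv inv_closed)
      ultimately show "i = j \<and> h = h'" by blast
    qed
  qed
  then have "cyclic (2 ^ k) \<times>\<times> G\<lparr>carrier := H\<rparr> \<cong> G" by (rule is_isoI)
  moreover have "group (cyclic (2 ^ k) \<times>\<times> G\<lparr>carrier := H\<rparr>)"
    by (intro DirProd_group group_integer_mod_group H.subgroup_is_group is_group)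
  ultimately show ?thesis using group.iso_sym \<open>k \<noteq> 0\<close> H(1) k k_min by blast
qed

end

section \<open>Counting powers, and isomorphisms of direct products\<close>

lemma powers_iso:
  assumes "G \<cong> H" "group G" "group H"
  shows "card (powers G m) = card (powers H m)"
proof -
  obtain h where h: "h \<in> hom G H" "bij_betw h (carrier G) (carrier H)"
    using assms by (auto simp: is_iso_def iso_def)
  interpret G: group G by fact
  have "powers H m = h ` powers G m"
    using h(1) bij_betw_imp_surj_on[OF h(2), symmetric]
    by (simp add: powers_def image_image hom_nat_pow[OF h(1) _ assms(2,3)])
  moreover have "inj_on h (powers G m)"
    using bij_betw_imp_inj_on[OF h(2)] by (rule inj_on_subset) (auto simp: powers_def)
  ultimately show ?thesis by (simp add: card_image)
qed

lemma powers_DirProd: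
  assumes "group G" "group H"
  shows "card (powers (G \<times>\<times> H) m) = card (powers G m) * card (powers H m)"
proof -
  have "x [^]\<^bsub>G \<times>\<times> H\<^esub> m = (fst x [^]\<^bsub>G\<^esub> m, snd x [^]\<^bsub>H\<^esub> m)" for x
    by (cases x; induction m) (auto simp: DirProd_def)
  then have "powers (G \<times>\<times> H) m = powers G m \<times> powers H m"
    by (force simp: powers_def image_def)
  then show ?thesis by (simp add: card_cartesian_product)
qed

text \<open>For \<open>j \<le> e\<close>, 2^j x modulo 2^e is 2^j times x modulo 2^(e-j). For
  \<open>j > e\<close> the truncated difference is 0, which matches the trivial subgroup.\<close>

lemma card_powers_cyclic: "card (powers (cyclic (2 ^ e)) (2 ^ j)) = 2 ^ (e - j)"
proof (cases "j \<le> e")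
  case True
  then obtain l where l: "e = j + l" using le_Suc_ex by blast
  have "powers (cyclic (2 ^ e)) (2 ^ j) = (\<lambda>x. 2 ^ j * x) ` {0..<2 ^ l :: int}"
  proof (intro subset_antisym subsetI)
    fix y assume "y \<in> powers (cyclic (2 ^ e)) (2 ^ j)"
    then obtain x :: int where "y = 2 ^ j * x mod 2 ^ e" by (auto simp: powers_def)
    then have "y = 2 ^ j * (x mod 2 ^ l)" by (simp only: l power_add mult_mod_right)
    then show "y \<in> (\<lambda>x. 2 ^ j * x) ` {0..<2 ^ l :: int}" by auto
  next
    fix y assume "y \<in> (\<lambda>x. 2 ^ j * x) ` {0..<2 ^ l :: int}"
    then obtain x :: int where x: "y = 2 ^ j * x" "0 \<le> x" "x < 2 ^ l" by auto
    then have "y = 2 ^ j * x mod 2 ^ e"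
      unfolding l power_add mult_mod_right[symmetric] by simp
    moreover have "x < 2 ^ e"
      using x(3) power_increasing[of l e "2::int"] unfolding l by linarith
    ultimately show "y \<in> powers (cyclic (2 ^ e)) (2 ^ j)"
      using x by (auto simp: powers_def carrier_integer_mod_group image_iff intro!: bexI[of _ x])
  qed
  moreover have "inj_on (\<lambda>x. 2 ^ j * x) {0..<2 ^ l :: int}" by (auto intro: inj_onI)
  ultimately show ?thesis by (simp add: card_image l)
next
  case False
  have "powers (cyclic (2 ^ e)) (2 ^ j) = {0}"
  proof -
    have "2 ^ j * x mod 2 ^ e = 0" for x :: int
      using False by (simp add: le_imp_power_dvd dvd_mult2)
    then have "powers (cyclic (2 ^ e)) (2 ^ j) = (\<lambda>x. 0) ` carrier (cyclic (2 ^ e))"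
      by (simp add: powers_def)
    moreover have "carrier (cyclic (2 ^ e)) \<noteq> {}" using integer_mod_group_0 by blast
    ultimately show ?thesis by (simp only: image_constant_conv if_False)
  qed
  then show ?thesis using False by simp
qed

lemma DirProd_swap_iso: "A \<times>\<times> (B \<times>\<times> C) \<cong> B \<times>\<times> (A \<times>\<times> C)"
proof (rule is_isoI)
  show "(\<lambda>(a, b, c). (b, a, c)) \<in> iso (A \<times>\<times> (B \<times>\<times> C)) (B \<times>\<times> (A \<times>\<times> C))"
    by (rule group_isomorphisms_imp_iso[where g = "\<lambda>(b, a, c). (a, b, c)"])
      (auto simp: group_isomorphisms_def hom_def)
qed

lemma DirProd_trivial_iso:
  assumes "group H" "order H = 1"
  shows "G \<times>\<times> H \<cong> G"
proof (rule is_isoI)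
  interpret H: group H by fact
  obtain z where "carrier H = {z}" using assms(2) by (auto simp: order_def card_1_singleton_iff)
  then have "carrier H = {\<one>\<^bsub>H\<^esub>}" using H.one_closed by auto
  then show "fst \<in> iso (G \<times>\<times> H) G"
    by (auto simp: iso_def hom_def inj_on_def bij_betw_def)
qed

lemma DirProd_cong_right: "group A \<Longrightarrow> B \<cong> C \<Longrightarrow> A \<times>\<times> B \<cong> A \<times>\<times> C"
  by (rule group.DirProd_iso_trans[OF _ iso_refl])

lemma order_cyclic: "order (cyclic (2 ^ k)) = 2 ^ k"
  by (simp add: order_def carrier_integer_mod_group)

text \<open>The complement is a structure of the same type as \<open>G\<close>, so the splitting can
  be repeated. The last clause of one splitting feeds the minimality clause of the next, which makes
  the exponents of successive factors weakly decreasing.\<close>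

lemma two_group_split_obtain:
  fixes G :: "('a, 'b) monoid_scheme"
  assumes "comm_group G" "order G = 2 ^ n" "n \<noteq> 0"
  obtains k m and H :: "('a, 'b) monoid_scheme"
  where "k \<noteq> 0" "n = k + m" "comm_group H" "order H = 2 ^ m" "G \<cong> cyclic (2 ^ k) \<times>\<times> H"
    "\<And>l. (\<And>x. x \<in> carrier G \<Longrightarrow> x [^]\<^bsub>G\<^esub> (2 ^ l :: nat) = \<one>\<^bsub>G\<^esub>) \<Longrightarrow> k \<le> l"
    "\<And>x. x \<in> carrier H \<Longrightarrow> x [^]\<^bsub>H\<^esub> (2 ^ k :: nat) = \<one>\<^bsub>H\<^esub>"
proof -
  interpret comm_group G by fact
  from two_group_split[OF assms(2,3)]
  obtain k H where k: "k \<noteq> 0" "subgroup H G" "\<forall>x\<in>carrier G. x [^]\<^bsub>G\<^esub> (2 ^ k :: nat) = \<one>\<^bsub>G\<^esub>"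
    "\<forall>l. (\<forall>x\<in>carrier G. x [^]\<^bsub>G\<^esub> (2 ^ l :: nat) = \<one>\<^bsub>G\<^esub>) \<longrightarrow> k \<le> l"
    "G \<cong> cyclic (2 ^ k) \<times>\<times> G\<lparr>carrier := H\<rparr>"
    by (elim exE conjE)
  let ?H = "G\<lparr>carrier := H\<rparr>"
  have cH: "comm_group ?H" 
    by (rule group.group_comm_groupI[OF subgroup.subgroup_is_group[OF k(2) is_group]])
      (use subgroup.mem_carrier[OF k(2)] m_comm in simp)
  have "order G = order (cyclic (2 ^ k)) * order ?H"
    using iso_same_card[OF k(5)] by (simp add: order_def card_cartesian_product)
  then have eq: "2 ^ n = 2 ^ k * order ?H" using assms(2) by (simp add: order_cyclic)
  then have "order ?H dvd 2 ^ n" by simp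
  then obtain m where m: "order ?H = 2 ^ m" using divides_primepow_nat[OF two_is_prime_nat] by blast
  have "n = k + m" using eq by (simp add: m power_add[symmetric])
  show thesis
  proof (rule that[OF k(1) \<open>n = k + m\<close> cH m k(5)])
    show "k \<le> l" if "\<And>x. x \<in> carrier G \<Longrightarrow> x [^]\<^bsub>G\<^esub> (2 ^ l :: nat) = \<one>\<^bsub>G\<^esub>" for l
      using k(4) that by blast
    show "x [^]\<^bsub>?H\<^esub> (2 ^ k :: nat) = \<one>\<^bsub>?H\<^esub>" if "x \<in> carrier ?H" for x
      using k(3) that subgroup.mem_carrier[OF k(2)] by (simp add: nat_pow_consistent[symmetric])
  qed
qed

section \<open>Arithmetic of the cyclic factors and the resulting classification\<close>

lemma card_powers_split:
  assumes "G \<cong> cyclic (2 ^ k) \<times>\<times> H" "comm_group G" "comm_group H"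
  shows "card (powers G (2 ^ j)) = 2 ^ (k - j) * card (powers H (2 ^ j))"
proof -
  have "group G" "group H" using assms comm_group.axioms(2) by blast+
  then show ?thesis
    using powers_iso[OF assms(1)] by (simp add: DirProd_group powers_DirProd card_powers_cyclic)
qed

lemma card_powers_two_power:
  assumes "comm_group H" "order H = 2 ^ m"
  obtains v where "card (powers H j) = 2 ^ v" "v \<le> m"
proof -
  interpret comm_group H by fact
  have "card (powers H j) dvd 2 ^ m"
    using lagrange[OF subgroup_powers, of j] assms(2) by (metis dvd_triv_right)
  then show thesis using that divides_primepow_nat[OF two_is_prime_nat] by blast
qed

text \<open>With k = r - 2 and j = 0 the bound below reads n \<le> 1 + (r - 2) + s = n - 1, which
  excludes such \<open>r\<close>. For r = 4 the inequality fails.\<close>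

lemma less_two_power_minus_2: "r \<ge> 5 \<Longrightarrow> r + 1 \<le> 2 ^ (r - 2)" for r :: nat
proof (induction r rule: nat_induct_at_least)
  case (Suc n)
  then have "(2::nat) ^ (Suc n - 2) = 2 * 2 ^ (n - 2)"
    by (simp flip: power_Suc add: Suc_diff_le)
  then show ?case using Suc by simp
qed simp

text \<open>The hypothesis \<open>bound\<close> is the logarithm of the inequality of \<open>orbit_bound\<close>. It is used with
  \<open>(r, k, j)\<close> equal to \<open>(2, 2, 2)\<close>, \<open>(3, 2, 1)\<close> and \<open>(4, 3, 1)\<close>, and, to exclude rank
  \<open>r \<ge> 5\<close>, with \<open>(r, r - 2, 0)\<close>.\<close>

lemma two_group_classification:
  fixes N :: "('a, 'b) monoid_scheme"
  assumes N: "comm_group N" "order N = 2 ^ n" and "n \<ge> 2"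
    and bound: "\<And>r s k j t. card (powers N (2 ^ 1)) = 2 ^ s \<Longrightarrow> n = r + s \<Longrightarrow> r + 1 \<le> 2 ^ k \<Longrightarrow>
      card (powers N (2 ^ Suc j)) = 2 ^ t \<Longrightarrow> n \<le> 1 + k + j + t"
  shows "N \<cong> cyclic (2 ^ n) \<or>
    N \<cong> cyclic 2 \<times>\<times> cyclic (2 ^ (n - 1)) \<or>
    (n \<ge> 3 \<and> N \<cong> cyclic 4 \<times>\<times> cyclic (2 ^ (n - 2))) \<or>
    (n \<ge> 3 \<and> N \<cong> cyclic 2 \<times>\<times> cyclic 2 \<times>\<times> cyclic (2 ^ (n - 2))) \<or>
    (n \<ge> 4 \<and> N \<cong> cyclic 2 \<times>\<times> cyclic 2 \<times>\<times> cyclic 2 \<times>\<times> cyclic (2 ^ (n - 3)))"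
proof -
  note grp = comm_group.axioms(2) group_integer_mod_group DirProd_group
  have triv: "G \<cong> cyclic (2 ^ k)" if "G \<cong> cyclic (2 ^ k) \<times>\<times> H" "comm_group H" "order H = 2 ^ m" "m = 0"
    for G H :: "('a, 'b) monoid_scheme" and k m
    using iso_trans[OF that(1) DirProd_trivial_iso] that(2-4) by (simp add: comm_group.axioms(2))
  have triv_pow: "card (powers H j) = 1" if "comm_group H" "order H = 2 ^ m" "m = 0"
    for H :: "('a, 'b) monoid_scheme" and m j
    using card_powers_two_power[OF that(1,2), of j] that(3) by auto
  obtain k1 m1 and H1 :: "('a, 'b) monoid_scheme"
    where 1: "k1 \<noteq> 0" "n = k1 + m1" "comm_group H1" "order H1 = 2 ^ m1" "N \<cong> cyclic (2 ^ k1) \<times>\<times> H1"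
    and e1: "\<And>x. x \<in> carrier H1 \<Longrightarrow> x [^]\<^bsub>H1\<^esub> (2 ^ k1 :: nat) = \<one>\<^bsub>H1\<^esub>"
    using two_group_split_obtain[OF N] \<open>n \<ge> 2\<close> by (metis not_numeral_le_zero)
  note pw1 = card_powers_split[OF 1(5) N(1) 1(3)]
  show ?thesis
  proof (cases "m1 = 0")
    case True
    then show ?thesis using triv[OF 1(5,3,4)] 1(2) by simp
  next
    case False
    then obtain k2 m2 and H2 :: "('a, 'b) monoid_scheme"
      where 2: "k2 \<noteq> 0" "m1 = k2 + m2" "comm_group H2" "order H2 = 2 ^ m2" "H1 \<cong> cyclic (2 ^ k2) \<times>\<times> H2"
      and k2: "k2 \<le> k1"
      and e2: "\<And>x. x \<in> carrier H2 \<Longrightarrow> x [^]\<^bsub>H2\<^esub> (2 ^ k2 :: nat) = \<one>\<^bsub>H2\<^esub>"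
      using two_group_split_obtain[OF 1(3,4)] e1 by metis
    note pw2 = card_powers_split[OF 2(5) 1(3) 2(3)]
    show ?thesis
    proof (cases "m2 = 0")
      case True
      have "card (powers N (2 ^ 1)) = 2 ^ (k1 - 1 + (k2 - 1))"
        "card (powers N (2 ^ Suc 2)) = 2 ^ (k1 - 3 + (k2 - 3))"
        unfolding pw1 pw2 triv_pow[OF 2(3,4) True] by (simp_all add: power_add numeral_3_eq_3 numeral_2_eq_2)
      note c = this
      have n_eq: "n = 2 + (k1 - 1 + (k2 - 1))" using 1(1,2) 2(1,2) True by linarith
      have "n \<le> 1 + 2 + 2 + (k1 - 3 + (k2 - 3))"
        using bound[where k = 2, OF c(1) n_eq _ c(2)] by simp
      \<comment> \<open>The differences are truncated. Were k2 \<ge> 3, both would be genuine, as k1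
        \<ge> k2, and the bound would read k1 + k2 \<le> k1 + k2 - 1.\<close>
      then have "k2 \<le> 2" using 1(2) 2(2) True k2 by linarith
      have "N \<cong> cyclic (2 ^ k1) \<times>\<times> cyclic (2 ^ k2)"
        using iso_trans[OF 1(5) DirProd_cong_right] triv[OF 2(5,3,4) True] by simp
      then have iso: "N \<cong> cyclic (2 ^ k2) \<times>\<times> cyclic (2 ^ k1)"
        using iso_trans DirProd_commute_iso by blast
      consider "k2 = 1" | "k2 = 2" using 2(1) \<open>k2 \<le> 2\<close> by linarith
      then show ?thesis
      proof cases
        case 1
        then have "k1 = n - 1" using \<open>n = k1 + m1\<close> 2(2) True by simp
        then show ?thesis using iso 1 by simp
      next
        case 2
        then have "k1 = n - 2" "n \<ge> 3" using \<open>n = k1 + m1\<close> \<open>m1 = k2 + m2\<close> True k2 by simp_all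
        then show ?thesis using iso 2 by simp
      qed
    next
      case False
      then obtain k3 m3 and H3 :: "('a, 'b) monoid_scheme"
        where 3: "k3 \<noteq> 0" "m2 = k3 + m3" "comm_group H3" "order H3 = 2 ^ m3" "H2 \<cong> cyclic (2 ^ k3) \<times>\<times> H3"
        and k3: "k3 \<le> k2"
        and e3: "\<And>x. x \<in> carrier H3 \<Longrightarrow> x [^]\<^bsub>H3\<^esub> (2 ^ k3 :: nat) = \<one>\<^bsub>H3\<^esub>"
        using two_group_split_obtain[OF 2(3,4)] e2 by metis
      note pw3 = card_powers_split[OF 3(5) 2(3) 3(3)]
      show ?thesis
      proof (cases "m3 = 0")
        case True
        have "card (powers N (2 ^ 1)) = 2 ^ (k1 - 1 + (k2 - 1) + (k3 - 1))"
          "card (powers N (2 ^ Suc 1)) = 2 ^ (k1 - 2 + (k2 - 2) + (k3 - 2))"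
          unfolding pw1 pw2 pw3 triv_pow[OF 3(3,4) True] by (simp_all add: power_add numeral_2_eq_2)
        note c = this
        have n_eq: "n = 3 + (k1 - 1 + (k2 - 1) + (k3 - 1))"
          using 1(1,2) 2(1,2) 3(1,2) True by linarith
        have "n \<le> 1 + 2 + 1 + (k1 - 2 + (k2 - 2) + (k3 - 2))"
          using bound[where k = 2, OF c(1) n_eq _ c(2)] by simp
        \<comment> \<open>Were k2 \<ge> 2, the bound would reduce to k3 \<le> k3 - 2 with
          truncation, contrary to k3 \<noteq> 0.\<close>
        then have "k2 = 1" "k3 = 1" using 1(1,2) 2(1,2) 3(1,2) True k2 k3 by linarith+
        then have k1: "k1 = n - 2" "n \<ge> 3" using 1(1,2) 2(2) 3(2) True by simp_all
        have "H1 \<cong> cyclic 2 \<times>\<times> cyclic 2"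
          using iso_trans[OF 2(5) DirProd_cong_right] triv[OF 3(5,3,4) True] \<open>k2 = 1\<close> \<open>k3 = 1\<close> by simp
        then have "N \<cong> cyclic (2 ^ k1) \<times>\<times> cyclic 2 \<times>\<times> cyclic 2"
          using iso_trans[OF 1(5) DirProd_cong_right] by simp
        also have "\<dots> \<cong> cyclic 2 \<times>\<times> cyclic (2 ^ k1) \<times>\<times> cyclic 2"
          by (rule DirProd_swap_iso)
        also have "\<dots> \<cong> cyclic 2 \<times>\<times> cyclic 2 \<times>\<times> cyclic (2 ^ k1)"
          by (intro DirProd_cong_right grp DirProd_commute_iso)
        finally show ?thesis using k1 by simp
      next
        case False
        then obtain k4 m4 and H4 :: "('a, 'b) monoid_scheme"
          where 4: "k4 \<noteq> 0" "m3 = k4 + m4" "comm_group H4" "order H4 = 2 ^ m4" "H3 \<cong> cyclic (2 ^ k4) \<times>\<times> H4"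
          and k4: "k4 \<le> k3"
          using two_group_split_obtain[OF 3(3,4)] e3 by metis
        note pw4 = card_powers_split[OF 4(5) 3(3) 4(3)]
        show ?thesis
        proof (cases "m4 = 0")
          case True
          have "card (powers N (2 ^ 1)) = 2 ^ (k1 - 1 + (k2 - 1) + (k3 - 1) + (k4 - 1))"
            "card (powers N (2 ^ Suc 1)) = 2 ^ (k1 - 2 + (k2 - 2) + (k3 - 2) + (k4 - 2))"
            unfolding pw1 pw2 pw3 pw4 triv_pow[OF 4(3,4) True] by (simp_all add: power_add numeral_2_eq_2)
          note c = this
          have n_eq: "n = 4 + (k1 - 1 + (k2 - 1) + (k3 - 1) + (k4 - 1))"
            using 1(1,2) 2(1,2) 3(1,2) 4(1,2) True by linarith
          have "n \<le> 1 + 3 + 1 + (k1 - 2 + (k2 - 2) + (k3 - 2) + (k4 - 2))"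
            using bound[where k = 3, OF c(1) n_eq _ c(2)] by simp
          \<comment> \<open>Were k2 \<ge> 2, the bound would reduce to k3 + k4 \<le> 1 + (k3 - 2) +
            (k4 - 2), but each truncated difference loses at least 1.\<close>
          then have k: "k2 = 1" "k3 = 1" "k4 = 1"
            using 1(1,2) 2(1,2) 3(1,2) 4(1,2) True k2 k3 k4 by linarith+
          then have k1: "k1 = n - 3" "n \<ge> 4" using 1(1,2) 2(2) 3(2) 4(2) True by simp_all
          have "H2 \<cong> cyclic 2 \<times>\<times> cyclic 2"
            using iso_trans[OF 3(5) DirProd_cong_right] triv[OF 4(5,3,4) True] k by simp
          then have "H1 \<cong> cyclic 2 \<times>\<times> cyclic 2 \<times>\<times> cyclic 2"
            using iso_trans[OF 2(5) DirProd_cong_right] k by simp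
          then have "N \<cong> cyclic (2 ^ k1) \<times>\<times> cyclic 2 \<times>\<times> cyclic 2 \<times>\<times> cyclic 2"
            using iso_trans[OF 1(5) DirProd_cong_right] by simp
          also have "\<dots> \<cong> cyclic 2 \<times>\<times> cyclic (2 ^ k1) \<times>\<times> cyclic 2 \<times>\<times> cyclic 2"
            by (rule DirProd_swap_iso)
          also have "\<dots> \<cong> cyclic 2 \<times>\<times> cyclic 2 \<times>\<times> cyclic (2 ^ k1) \<times>\<times> cyclic 2"
            by (intro DirProd_cong_right grp DirProd_swap_iso)
          also have "\<dots> \<cong> cyclic 2 \<times>\<times> cyclic 2 \<times>\<times> cyclic 2 \<times>\<times> cyclic (2 ^ k1)"
            by (intro DirProd_cong_right grp DirProd_commute_iso)
          finally show ?thesis using k1 by simp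
        next
          case False
          then obtain k5 m5 and H5 :: "('a, 'b) monoid_scheme"
            where 5: "k5 \<noteq> 0" "m4 = k5 + m5" "comm_group H5" "order H5 = 2 ^ m5" "H4 \<cong> cyclic (2 ^ k5) \<times>\<times> H5"
            using two_group_split_obtain[OF 4(3,4)] by metis
          obtain v where v: "card (powers H5 (2 ^ 1)) = 2 ^ v" "v \<le> m5"
            using card_powers_two_power[OF 5(3,4)] by blast
          note pw5 = card_powers_split[OF 5(5) 4(3) 5(3)]
          \<comment> \<open>2^s is the order of 2N. Each of the five cyclic factors loses 1 in the
            exponent and \<open>H5\<close> loses m5 - v \<ge> 0, so the rank n - s is at least
            5.\<close>
          define s where "s = k1 - 1 + (k2 - 1) + (k3 - 1) + (k4 - 1) + (k5 - 1) + v"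
          have s: "card (powers N (2 ^ 1)) = 2 ^ s"
            unfolding pw1 pw2 pw3 pw4 pw5 v s_def by (simp add: power_add)
          have "n - s \<ge> 5" "n \<ge> s"
            using 1(1,2) 2(1,2) 3(1,2) 4(1,2) 5(1,2) v(2) by (auto simp: s_def)
          then have "n \<le> 1 + (n - s - 2) + 0 + s"
            using bound[OF s, of "n - s" "n - s - 2" 0 s] s less_two_power_minus_2[OF \<open>n - s \<ge> 5\<close>] by simp
          then show ?thesis using \<open>n - s \<ge> 5\<close> by simp
        qed
      qed
    qed
  qed
qed

section \<open>Regular quaternion and dihedral subgroups\<close>

text \<open>\<open>S\<close> is the cyclic group of \<open>x\<close> together with its coset of
  \<open>y\<close>. Left multiplication by letters is considered because words grow at the front.
  \<open>yx\<close> moves \<open>y\<close> past powers of \<open>x\<close>, inverting them, and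
  \<open>yy\<close> absorbs a second \<open>y\<close>.\<close>

lemma (in group) cyclic_union_coset_closed:
  assumes xy: "x \<in> carrier G" "y \<in> carrier G" and m: "x [^] (m::nat) = \<one>" "m > 0"
    and yx: "y \<otimes> x = inv x \<otimes> y" and yy: "y \<otimes> y = x [^] (l::nat)"
    and S: "S = {x [^] (i::nat) \<otimes> z | i z. z \<in> {\<one>, y}}" and s: "s \<in> S"
  shows "x \<otimes> s \<in> S" "inv x \<otimes> s \<in> S" "y \<otimes> s \<in> S" "inv y \<otimes> s \<in> S"
proof -
  have S_I: "x [^] i \<in> S" "x [^] i \<otimes> y \<in> S" for i :: nat
    using xy unfolding S by (force intro!: exI[of _ i])+
  have x_S: "x [^] i \<otimes> s \<in> S" if "s \<in> S" for i :: nat and s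
    using that xy S_I by (auto simp: S m_assoc[symmetric] nat_pow_mult)
  \<comment> \<open>\<open>S\<close> has natural exponents only; x^m = 1 turns inverses into such
    powers.\<close>
  have inv_x: "inv x = x [^] (m - 1)"
    using m xy nat_pow_Suc[of x "m - 1"] by (metis Suc_diff_1 inv_equality nat_pow_closed)
  have y_pow: "y \<otimes> x [^] i = x [^] ((m - 1) * i) \<otimes> y" for i :: nat
  proof (induction i)
    case (Suc i)
    have "y \<otimes> x [^] Suc i = (y \<otimes> x [^] i) \<otimes> x" using xy by (simp add: m_assoc)
    also have "\<dots> = x [^] ((m - 1) * i) \<otimes> (x [^] (m - 1) \<otimes> y)"
      using xy by (simp add: Suc.IH m_assoc yx inv_x)
    also have "\<dots> = x [^] ((m - 1) * Suc i) \<otimes> y"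
      using xy by (simp add: m_assoc[symmetric] nat_pow_mult add.commute)
    finally show ?case .
  qed (use xy in simp)
  have y_S: "y \<otimes> s \<in> S" if sS: "s \<in> S" for s
  proof -
    obtain i :: nat and z where iz: "s = x [^] i \<otimes> z" "z \<in> {\<one>, y}" using sS unfolding S by blast
    then have "y \<otimes> s = x [^] ((m - 1) * i) \<otimes> (y \<otimes> z)"
      using xy by (auto simp: m_assoc[symmetric] y_pow)
    moreover have "y \<otimes> z \<in> S" using iz(2) xy S_I(1)[of l] S_I(2)[of 0] by (auto simp: yy)
    ultimately show ?thesis using x_S by simp
  qed
  have s_car: "s \<in> carrier G" using s xy by (auto simp: S)
  show "x \<otimes> s \<in> S" using x_S[OF s, of 1] xy by simp
  show "inv x \<otimes> s \<in> S" using x_S[OF s] inv_x by simp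
  show "y \<otimes> s \<in> S" by (rule y_S[OF s])
  have "inv y = inv (y \<otimes> y) \<otimes> y" using xy by (simp add: inv_mult_group m_assoc)
  also have "\<dots> = x [^] ((m - 1) * l) \<otimes> y"
    using xy by (simp add: yy nat_pow_inv[symmetric] inv_x nat_pow_pow)
  finally show "inv y \<otimes> s \<in> S"
    using x_S[OF y_S[OF s]] xy s_car by (simp add: m_assoc)
qed

text \<open>The relations bound the group from above in terms of the powers of \<open>x\<close>; its
  order enters through regularity, which equates it with the order of N.\<close>

lemma presented_group_index_two:
  assumes "(X_pow m, []) \<in> R" "m > 0" "([(Y, True), (X, True)], [(X, False), (Y, True)]) \<in> R"
    and "([(Y, True), (Y, True)], X_pow l) \<in> R"
  obtains x where "x \<in> carrier (presented_group R)" "x [^]\<^bsub>presented_group R\<^esub> m = \<one>\<^bsub>presented_group R\<^esub>"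
    "finite (carrier (presented_group R))"
    "card (carrier (presented_group R)) \<le> 2 * card (range (\<lambda>i::nat. x [^]\<^bsub>presented_group R\<^esub> i))"
proof -
  let ?P = "presented_group R" and ?c = "pres_class R"
  interpret P: group ?P by (rule group_presented_group)
  define x y where "x = ?c [(X, True)]" and "y = ?c [(Y, True)]"
  have car: "?c w \<in> carrier ?P" for w by (simp add: presented_group_def)
  have one: "\<one>\<^bsub>?P\<^esub> = ?c []" by (simp add: presented_group_def)
  have xy: "x \<in> carrier ?P" "y \<in> carrier ?P" by (simp_all add: x_def y_def car)
  have rel: "?c u = ?c v" if "(u, v) \<in> R" for u v
    using that by (simp add: pres_class_eq_iff pres_eq.rel)
  have inv_letter: "inv\<^bsub>?P\<^esub> ?c [(g, True)] = ?c [(g, False)]" for g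
    using pres_eq.cancel[of R g False] by (intro P.inv_equality car) (simp add: mult_pres_class one pres_class_eq_iff)
  have X_pow: "?c (X_pow k) = x [^]\<^bsub>?P\<^esub> k" for k
  proof (induction k)
    case (Suc k)
    have "X_pow (Suc k) = X_pow k @ [(X, True)]" by (simp add: replicate_append_same)
    then show ?case by (simp add: mult_pres_class[symmetric] Suc x_def del: replicate.simps)
  qed (simp add: one)
  have xm: "x [^]\<^bsub>?P\<^esub> m = \<one>\<^bsub>?P\<^esub>" using rel[OF assms(1)] by (simp add: X_pow one)
  have yx: "y \<otimes>\<^bsub>?P\<^esub> x = inv\<^bsub>?P\<^esub> x \<otimes>\<^bsub>?P\<^esub> y"
    using rel[OF assms(3)] by (simp add: x_def y_def mult_pres_class inv_letter)
  have yy: "y \<otimes>\<^bsub>?P\<^esub> y = x [^]\<^bsub>?P\<^esub> l"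
    using rel[OF assms(4)] by (simp add: y_def mult_pres_class X_pow)
  define S where "S = {x [^]\<^bsub>?P\<^esub> (i::nat) \<otimes>\<^bsub>?P\<^esub> z | i z. z \<in> {\<one>\<^bsub>?P\<^esub>, y}}"
  note closed = P.cyclic_union_coset_closed[OF xy xm assms(2) yx yy S_def]
  have "?c w \<in> S" for w
  proof (induction w)
    case Nil
    show ?case unfolding S_def by (intro CollectI exI[of _ 0] exI[of _ "\<one>\<^bsub>?P\<^esub>"]) (simp add: one[symmetric])
  next
    case (Cons b w)
    have "?c (b # w) = ?c [b] \<otimes>\<^bsub>?P\<^esub> ?c w" by (simp add: mult_pres_class)
    moreover have "?c [b] \<in> {x, inv\<^bsub>?P\<^esub> x, y, inv\<^bsub>?P\<^esub> y}"
    proof -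
      obtain g e where "b = (g, e)" by (cases b)
      then show ?thesis by (cases g; cases e) (auto simp: x_def y_def inv_letter)
    qed
    ultimately show ?case using closed[OF Cons.IH] by auto
  qed
  then have sub: "carrier ?P \<subseteq> S" by (auto simp: presented_group_def)
  define A where "A = range (\<lambda>i::nat. x [^]\<^bsub>?P\<^esub> i)"
  have "A \<subseteq> (\<lambda>i. x [^]\<^bsub>?P\<^esub> i) ` {..<m}"
  proof
    fix a assume "a \<in> A"
    then obtain i :: nat where a: "a = x [^]\<^bsub>?P\<^esub> i" by (auto simp: A_def)
    have "x [^]\<^bsub>?P\<^esub> i = x [^]\<^bsub>?P\<^esub> (m * (i div m) + i mod m)" by simp
    also have "\<dots> = (x [^]\<^bsub>?P\<^esub> m) [^]\<^bsub>?P\<^esub> (i div m) \<otimes>\<^bsub>?P\<^esub> x [^]\<^bsub>?P\<^esub> (i mod m)"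
      using xy by (simp only: P.nat_pow_mult P.nat_pow_pow)
    also have "\<dots> = x [^]\<^bsub>?P\<^esub> (i mod m)"
      using xy by (simp only: xm P.nat_pow_one P.l_one P.nat_pow_closed)
    finally show "a \<in> (\<lambda>i. x [^]\<^bsub>?P\<^esub> i) ` {..<m}" using a assms(2) by auto
  qed
  then have finA: "finite A" using finite_surj by blast
  have "S \<subseteq> A \<union> (\<lambda>a. a \<otimes>\<^bsub>?P\<^esub> y) ` A"
  proof
    fix s assume "s \<in> S"
    then obtain i :: nat and z where iz: "s = x [^]\<^bsub>?P\<^esub> i \<otimes>\<^bsub>?P\<^esub> z" "z = \<one>\<^bsub>?P\<^esub> \<or> z = y"
      unfolding S_def by blast
    have i: "x [^]\<^bsub>?P\<^esub> i \<in> A" "x [^]\<^bsub>?P\<^esub> i \<in> carrier ?P" using xy by (simp_all add: A_def)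
    from iz(2) show "s \<in> A \<union> (\<lambda>a. a \<otimes>\<^bsub>?P\<^esub> y) ` A"
    proof
      assume "z = \<one>\<^bsub>?P\<^esub>"
      then have "s = x [^]\<^bsub>?P\<^esub> i" using iz(1) i(2) P.r_one by metis
      then show ?thesis using i(1) by blast
    qed (use iz(1) i(1) in blast)
  qed
  then have "carrier ?P \<subseteq> A \<union> (\<lambda>a. a \<otimes>\<^bsub>?P\<^esub> y) ` A" using sub by blast
  then have "finite (carrier ?P)" "card (carrier ?P) \<le> card (A \<union> (\<lambda>a. a \<otimes>\<^bsub>?P\<^esub> y) ` A)"
    using finA by (auto intro: finite_subset card_mono)
  moreover have "\<dots> \<le> card A + card ((\<lambda>a. a \<otimes>\<^bsub>?P\<^esub> y) ` A)" by (rule card_Un_le)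
  moreover have "card ((\<lambda>a. a \<otimes>\<^bsub>?P\<^esub> y) ` A) \<le> card A" by (rule card_image_le[OF finA])
  ultimately have "finite (carrier ?P)" "card (carrier ?P) \<le> 2 * card A"
    by linarith+
  then show thesis using that xy xm by (simp add: A_def)
qed

text \<open>Both presentations have a relation y^2 = x^l: l = 2^(n-2) in the quaternion case and l =
  0 in the dihedral case, as \<open>X_pow 0\<close> is the empty word.\<close>

lemma quaternion_or_dihedral_index_two:
  assumes "P = quaternion_group n \<or> P = dihedral_group n"
  obtains x where "group P" "x \<in> carrier P" "x [^]\<^bsub>P\<^esub> (2 ^ (n - 1) :: nat) = \<one>\<^bsub>P\<^esub>"
    "finite (carrier P)" "card (carrier P) \<le> 2 * card (range (\<lambda>i::nat. x [^]\<^bsub>P\<^esub> i))"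
proof -
  have "\<exists>l R. P = presented_group R \<and> (X_pow (2 ^ (n - 1)), []) \<in> R \<and>
      ([(Y, True), (X, True)], [(X, False), (Y, True)]) \<in> R \<and> ([(Y, True), (Y, True)], X_pow l) \<in> R"
    using assms
  proof
    assume "P = quaternion_group n"
    then show ?thesis
      unfolding quaternion_group_def by (intro exI[of _ "2 ^ (n - 2)"] exI conjI) (assumption | simp)+
  next
    assume "P = dihedral_group n"
    then show ?thesis
      unfolding dihedral_group_def by (intro exI[of _ 0] exI conjI) (assumption | simp)+
  qed
  then obtain l R where P: "P = presented_group R" and R: "(X_pow (2 ^ (n - 1)), []) \<in> R"
    "([(Y, True), (X, True)], [(X, False), (Y, True)]) \<in> R" "([(Y, True), (Y, True)], X_pow l) \<in> R"
    by blast
  show thesis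
    by (rule presented_group_index_two[OF R(1) _ R(2,3)])
      (simp, rule that, simp_all only: P group_presented_group)
qed

section \<open>Regular subgroups of the holomorph and affine maps\<close>

lemma (in group) subgroup_carrier_Hol: "subgroup (carrier (Hol G)) (BijGroup (carrier G))"
proof -
  interpret h: group_hom "semidirect_Aut G" "BijGroup (carrier G)" "semidirect_Aut_perm G"
    using group_semidirect_Aut group_BijGroup semidirect_Aut_perm_hom
    by (simp add: group_hom_def group_hom_axioms_def)
  show ?thesis using h.img_is_subgroup by (simp add: Hol_def)
qed

lemma (in group) group_Hol: "group (Hol G)"
  using subgroup.subgroup_is_group[OF subgroup_carrier_Hol group_BijGroup] by (simp add: Hol_def)

text \<open>The affine map is the element of \<open>M\<close> corresponding to \<open>x\<close>. By
  regularity, evaluation at the identity is a bijection from \<open>M\<close> onto the group: it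
  gives |P| = |M| = |G| and turns the powers of that element into an orbit of the same size.\<close>

lemma (in group) regular_subgroup_affine_map:
  assumes M: "subgroup M (Hol G)" "regular_on M (carrier G)" and fin: "finite (carrier G)"
    and iso: "(Hol G)\<lparr>carrier := M\<rparr> \<cong> P" and P: "group P"
    and x: "x \<in> carrier P" "x [^]\<^bsub>P\<^esub> (m::nat) = \<one>\<^bsub>P\<^esub>"
    "card (carrier P) \<le> 2 * card (range (\<lambda>i::nat. x [^]\<^bsub>P\<^esub> i))"
  obtains f a where "f \<in> hom G G" "a \<in> carrier G"
    "\<And>z. z \<in> carrier G \<Longrightarrow> ((\<lambda>z. a \<otimes> f z) ^^ m) z = z"
    "order G \<le> 2 * card (range (\<lambda>i. ((\<lambda>z. a \<otimes> f z) ^^ i) \<one>))"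
proof -
  let ?H = "(Hol G)\<lparr>carrier := M\<rparr>"
  interpret H: group ?H by (rule subgroup.subgroup_is_group[OF M(1) group_Hol])
  obtain \<phi> where \<phi>: "\<phi> \<in> hom ?H P" "bij_betw \<phi> M (carrier P)"
    using iso by (auto simp: is_iso_def iso_def)
  obtain \<pi> where \<pi>: "\<pi> \<in> M" "\<phi> \<pi> = x" using x(1) \<phi>(2) by (metis bij_betwE bij_betw_inv_into bij_betw_inv_into_right)
  have M_Hol: "M \<subseteq> carrier (Hol G)" using subgroup.subset[OF M(1)] .
  then obtain a f where af: "\<pi> = semidirect_Aut_perm G (a, f)" "a \<in> carrier G" "f \<in> auto G"
    using \<pi>(1) by (auto simp: Hol_def semidirect_Aut_def carrier_AutoGroup)
  \<comment> \<open>Elements of \<open>Hol G\<close> are undefined outside the carrier;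
    \<open>p\<close> is the unrestricted formula, and \<open>pow\<close> compares the iterates on
    the carrier.\<close>
  define p where "p = (\<lambda>z. a \<otimes> f z)"
  have p_cl: "p z \<in> carrier G" if "z \<in> carrier G" for z using that af by (simp add: p_def auto_closed)
  have \<pi>_p: "\<pi> z = p z" if "z \<in> carrier G" for z
    using that by (simp add: af(1) p_def semidirect_Aut_perm_def)
  have M_Bij: "M \<subseteq> Bij (carrier G)"
    using M_Hol subgroup.subset[OF subgroup_carrier_Hol] by (auto simp: BijGroup_def)
  have mult: "(q \<otimes>\<^bsub>?H\<^esub> q') z = q (q' z)" if "q \<in> M" "q' \<in> M" "z \<in> carrier G" for q q' z
    using that M_Bij by (auto simp: Hol_def BijGroup_def compose_def)
  have one: "\<one>\<^bsub>?H\<^esub> = (\<lambda>z\<in>carrier G. z)" by (simp add: Hol_def BijGroup_def)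
  have \<pi>_H: "\<pi> \<in> carrier ?H" using \<pi> by simp
  have pow_M: "\<pi> [^]\<^bsub>?H\<^esub> i \<in> M" for i :: nat using H.nat_pow_closed[OF \<pi>_H] by simp
  have pow: "(\<pi> [^]\<^bsub>?H\<^esub> i) z = (p ^^ i) z" if "z \<in> carrier G" for i :: nat and z
    using that
  proof (induction i arbitrary: z)
    case 0
    then show ?case by (simp add: one[simplified])
  next
    case (Suc i)
    have "(\<pi> [^]\<^bsub>?H\<^esub> Suc i) z = (\<pi> [^]\<^bsub>?H\<^esub> i) (\<pi> z)"
      using mult[OF pow_M \<pi>(1) Suc.prems] by simp
    also have "\<dots> = (p ^^ i) (p z)" using Suc p_cl \<pi>_p by simp
    finally show ?case by (simp add: funpow_swap1)
  qed
  have \<phi>_pow: "\<phi> (\<pi> [^]\<^bsub>?H\<^esub> i) = x [^]\<^bsub>P\<^esub> i" for i :: nat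
    using hom_nat_pow[OF \<phi>(1) \<pi>_H H.is_group P] \<pi>(2) by simp
  \<comment> \<open>Uniqueness in regularity gives injectivity here; existence gives surjectivity
    below.\<close>
  have eval_inj: "inj_on (\<lambda>q. q \<one>) M"
  proof (rule inj_onI)
    fix q q' assume q: "q \<in> M" "q' \<in> M" "q \<one> = q' \<one>"
    moreover have "q \<one> \<in> carrier G" using q M_Bij Bij_imp_funcset by blast
    ultimately show "q = q'" using M(2) unfolding regular_on_def by (metis one_closed)
  qed
  have "(\<lambda>q. q \<one>) ` M = carrier G"
  proof (intro subset_antisym subsetI)
    fix z assume "z \<in> carrier G"
    then obtain q where "q \<in> M" "q \<one> = z" using M(2) unfolding regular_on_def by (metis one_closed)
    then show "z \<in> (\<lambda>q. q \<one>) ` M" by blast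
  qed (use M_Bij Bij_imp_funcset in blast)
  then have card_M: "card M = order G" "finite M"
    using card_image[OF eval_inj] finite_imageD[OF _ eval_inj] fin by (simp_all add: order_def)
  have "\<phi> (\<pi> [^]\<^bsub>?H\<^esub> m) = \<phi> \<one>\<^bsub>?H\<^esub>"
    using \<phi>_pow x(2) hom_one[OF \<phi>(1) H.is_group P] by simp
  then have "\<pi> [^]\<^bsub>?H\<^esub> m = \<one>\<^bsub>?H\<^esub>"
    using bij_betw_imp_inj_on[OF \<phi>(2)] pow_M H.one_closed by (simp add: inj_on_eq_iff)
  then have 1: "(p ^^ m) z = z" if "z \<in> carrier G" for z
    using pow[OF that, of m] that by (simp add: one[simplified])
  let ?R = "range (\<lambda>i::nat. \<pi> [^]\<^bsub>?H\<^esub> i)"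
  have R_M: "?R \<subseteq> M" using pow_M by blast
  have "range (\<lambda>i::nat. x [^]\<^bsub>P\<^esub> i) = \<phi> ` ?R"
    by (simp only: image_image \<phi>_pow)
  \<comment> \<open>\<phi> maps the powers of \<pi> onto those of \<open>x\<close>, so a lower bound
    on the number of the latter passes to the orbit.\<close>
  then have "card (range (\<lambda>i::nat. x [^]\<^bsub>P\<^esub> i)) \<le> card ?R"
    using card_image_le[of ?R \<phi>] R_M card_M(2) finite_subset by metis
  also have "card ?R = card ((\<lambda>q. q \<one>) ` ?R)"
    using card_image inj_on_subset[OF eval_inj R_M] by metis
  also have "(\<lambda>q. q \<one>) ` ?R = range (\<lambda>i. (p ^^ i) \<one>)"
    by (simp only: image_image pow[OF one_closed])
  finally have "order G \<le> 2 * card (range (\<lambda>i. (p ^^ i) \<one>))"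
    using x(3) bij_betw_same_card[OF \<phi>(2)] card_M(1) by linarith
  then show thesis
    using that[of f a] af 1 by (simp add: auto_def p_def)
qed

theorem theorem3p4:
  fixes N :: "('a, 'b) monoid_scheme" and n d :: nat
  assumes "n \<ge> 2"
    and "comm_group N"
    and "order N = 2 ^ n"
    and "group_exponent N = 2 ^ d"
    and "\<exists>M. subgroup M (Hol N) \<and> regular_on M (carrier N) \<and>
           ((Hol N)\<lparr>carrier := M\<rparr> \<cong> quaternion_group n \<or>
            (Hol N)\<lparr>carrier := M\<rparr> \<cong> dihedral_group n)"
  shows "N \<cong> cyclic (2 ^ n) \<or>
    N \<cong> cyclic 2 \<times>\<times> cyclic (2 ^ (n - 1)) \<or>
    (n \<ge> 3 \<and> N \<cong> cyclic 4 \<times>\<times> cyclic (2 ^ (n - 2))) \<or>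
    (n \<ge> 3 \<and> N \<cong> cyclic 2 \<times>\<times> cyclic 2 \<times>\<times> cyclic (2 ^ (n - 2))) \<or>
    (n \<ge> 4 \<and> N \<cong> cyclic 2 \<times>\<times> cyclic 2 \<times>\<times> cyclic 2 \<times>\<times> cyclic (2 ^ (n - 3)))"
proof -
  interpret N: comm_group N by fact
  have fin: "finite (carrier N)"
    using assms(3) by (metis N.order_gt_0_iff_finite zero_less_numeral zero_less_power)
  obtain M P where M: "subgroup M (Hol N)" "regular_on M (carrier N)" "(Hol N)\<lparr>carrier := M\<rparr> \<cong> P"
    and P: "P = quaternion_group n \<or> P = dihedral_group n"
    using assms(5) by blast
  obtain x where x: "group P" "x \<in> carrier P" "x [^]\<^bsub>P\<^esub> (2 ^ (n - 1) :: nat) = \<one>\<^bsub>P\<^esub>"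
    "card (carrier P) \<le> 2 * card (range (\<lambda>i::nat. x [^]\<^bsub>P\<^esub> i))"
    using quaternion_or_dihedral_index_two[OF P] by blast
  \<comment> \<open>The relation x^(2^(n-1)) = 1 makes the iterate of order 2^(n-1) the identity,
    which supplies S = n - 1 in the nilpotency argument.\<close>
  obtain f a where f: "f \<in> hom N N" "a \<in> carrier N"
    and id: "\<And>z. z \<in> carrier N \<Longrightarrow> ((\<lambda>z. a \<otimes>\<^bsub>N\<^esub> f z) ^^ (2 ^ (n - 1))) z = z"
    and orbit: "order N \<le> 2 * card (range (\<lambda>i. ((\<lambda>z. a \<otimes>\<^bsub>N\<^esub> f z) ^^ i) \<one>\<^bsub>N\<^esub>))"
    by (rule N.regular_subgroup_affine_map[OF M(1,2) fin M(3) x]) blast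
  interpret A: affine_map N f a using f by unfold_locales
  have p: "A.p = (\<lambda>z. a \<otimes>\<^bsub>N\<^esub> f z)" by (rule ext) (simp add: A.p_def)
  show ?thesis
  proof (rule two_group_classification[OF assms(2,3,1)])
    fix r s k j t
    assume s: "card (powers N (2 ^ 1)) = 2 ^ s" "n = r + s" and k: "r + 1 \<le> (2::nat) ^ k"
      and t: "card (powers N (2 ^ Suc j)) = 2 ^ t"
    \<comment> \<open>n = r + s says that N/2N has order 2^r, so \<open>r\<close> is the
      rank.\<close>
    have "order N = 2 ^ r * card (powers N 2)" using s assms(3) by (simp add: power_add)
    from A.orbit_bound[OF fin _ this k, of "n - 1" j]
    have "card (range (\<lambda>i. (A.p ^^ i) \<one>\<^bsub>N\<^esub>)) \<le> 2 ^ (k + j) * 2 ^ t"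
      using id t by (simp add: p)
    \<comment> \<open>The factor 2 is the index bound for the cyclic subgroup; it becomes the
      summand 1 in the exponent.\<close>
    then have "2 ^ n \<le> 2 * (2 ^ (k + j) * 2 ^ t :: nat)" using orbit assms(3) by (simp add: p)
    then have "(2::nat) ^ n \<le> 2 ^ (1 + k + j + t)" by (simp add: power_add mult_ac)
    then show "n \<le> 1 + k + j + t" by (rule power_le_imp_le_exp[rotated]) simp
  qed
qed

end
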